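(* Let $A\in\mathbb{Z}^{d\times n}$ have rank $d$ and let $b\in\mathbb{C}^n$. If the Lissajous discriminant variety $\nabla_{A,b}\subseteq\mathbb{C}^d$ is a hypersurface, then it has degree at most $$(\deg \mathrm{pr}_\omega)^{-1}\cdot d\cdot d!\,\operatorname{vol}(P_A),$$ where $\mathrm{pr}_\omega$ denotes the restriction $(\mathrm{pr}_\omega)_{|R_{A,b}} : R_{A,b}\to\nabla_{A,b}$, $P_A\subset\mathbb{R}^d$ is the convex hull of $\{\pm a_1,\dots,\pm a_n\}$ with $a_1,\dots,a_n$ the columns of $A$, and $\operatorname{vol}$ is the Euclidean volume.
   Context: Let $\beta_j = e^{-ib_j\pi/2}$ for $j=1,\dots,n$, and for $v\in(\mathbb{C}^* )^d$ write $v^{a_j}=\prod_k v_k^{a_{kj}}$. Define $$\psi_{A,b}:(\mathbb{C}^* )^d\to\mathbb{C}^n,\quad \psi_{A,b}(v) = \Big(\tfrac12(\beta_1v^{a_1}+\beta_1^{-1}v^{-a_1}),\dots,\tfrac12(\beta_nv^{a_n}+\beta_n^{-1}v^{-a_n})\Big).$$ The incidence variety is $W_{A,b} = \{(v,\omega)\in(\mathbb{C}^* )^d\times\mathbb{C}^d : A\,\psi_{A,b}(v)=\omega\}$ with projection $\mathrm{pr}_\omega:W_{A,b}\to\mathbb{C}^d$, $(v,\omega)\mapsto\omega$. The toric Jacobi matrix is $$J_{A,b}(v) = \tfrac12\,A\,\operatorname{diag}(\beta_1v^{a_1}-\beta_1^{-1}v^{-a_1},\dots,\beta_nv^{a_n}-\beta_n^{-1}v^{-a_n})\,A^t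 .$$ The ramification locus is the divisor $R_{A,b} = \{(v,\omega)\in W_{A,b} : \det J_{A,b}(v)=0\}$, and the Lissajous discriminant is the Zariski closure $\nabla_{A,b} = \overline{\mathrm{pr}_\omega(R_{A,b})}\subseteq\mathbb{C}^d$. The degree of $(\mathrm{pr}_\omega)_{|R_{A,b}}$ is the cardinality of a generic fiber: the positive integer $\delta_0$ such that $\{v : (v,\omega)\in R_{A,b}\}$ has exactly $\delta_0$ elements for all $\omega$ in a Zariski dense open subset of $\nabla_{A,b}$ (its existence is implicit in the statement). The degree of $\nabla_{A,b}$ is the number of its intersection points with a generic line. *)

theory Defs
  imports "HOL-Analysis.Analysis"
begin

inductive_set polyfuns :: "(complex^'k \<Rightarrow> complex) set" where
  const: "(\<lambda>_. c) \<in> polyfuns"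
| coord: "(\<lambda>x. x $ i) \<in> polyfuns"
| add: "f \<in> polyfuns \<Longrightarrow> g \<in> polyfuns \<Longrightarrow> (\<lambda>x. f x + g x) \<in> polyfuns"
| mult: "f \<in> polyfuns \<Longrightarrow> g \<in> polyfuns \<Longrightarrow> (\<lambda>x. f x * g x) \<in> polyfuns"

definition zero_locus :: "(complex^'k \<Rightarrow> complex) set \<Rightarrow> (complex^'k) set" where
  "zero_locus F = {x. \<forall>f\<in>F. f x = 0}"

definition zariski :: "(complex^'k) topology" where
  "zariski = topology (\<lambda>U. \<exists>F \<subseteq> polyfuns. U = - zero_locus F)"

lemma istopology_zariski:
  "istopology (\<lambda>U :: (complex^'k) set. \<exists>F \<subseteq> polyfuns. U = - zero_locus F)"
  unfolding istopology_def
proof (intro conjI allI impI)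
  fix S T :: "(complex^'k) set"
  assume "\<exists>F \<subseteq> polyfuns. S = - zero_locus F" "\<exists>F \<subseteq> polyfuns. T = - zero_locus F"
  then obtain F G where F: "F \<subseteq> polyfuns" "S = - zero_locus F"
    and G: "G \<subseteq> polyfuns" "T = - zero_locus G" by blast
  let ?H = "(\<lambda>(f, g) x. f x * g x) ` (F \<times> G)"
  have "?H \<subseteq> polyfuns"
    using F(1) G(1) by (auto intro!: polyfuns.mult)
  moreover have "S \<inter> T = - zero_locus ?H"
    using F(2) G(2) by (auto simp: zero_locus_def)
  ultimately show "\<exists>H \<subseteq> polyfuns. S \<inter> T = - zero_locus H" by blast
next
  fix \<K> :: "(complex^'k) set set"
  assume "\<forall>K\<in>\<K>. \<exists>F \<subseteq> polyfuns. K = - zero_locus F"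
  then obtain F where F: "\<And>K. K \<in> \<K> \<Longrightarrow> F K \<subseteq> polyfuns \<and> K = - zero_locus (F K)"
    by metis
  have "(\<Union>K\<in>\<K>. F K) \<subseteq> polyfuns"
    using F by blast
  moreover have "\<Union>\<K> = (\<Union>K\<in>\<K>. - zero_locus (F K))"
    using F by auto
  then have "\<Union>\<K> = - zero_locus (\<Union>K\<in>\<K>. F K)"
    by (auto simp: zero_locus_def)
  ultimately show "\<exists>H \<subseteq> polyfuns. \<Union>\<K> = - zero_locus H" by blast
qed

lemma openin_zariski: "openin zariski U \<longleftrightarrow> (\<exists>F \<subseteq> polyfuns. U = - zero_locus F)"
  unfolding zariski_def by (simp add: topology_inverse' istopology_zariski)

lemma topspace_zariski [simp]: "topspace zariski = UNIV"
proof -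
  have "openin zariski (- zero_locus {\<lambda>_. 1})"
    unfolding openin_zariski using polyfuns.const by blast
  then show ?thesis
    using openin_subset by (fastforce simp: zero_locus_def)
qed

lemma closedin_zariski: "closedin zariski C \<longleftrightarrow> (\<exists>F \<subseteq> polyfuns. C = zero_locus F)"
  unfolding closedin_def openin_zariski by (auto simp: Compl_eq_Diff_UNIV[symmetric])

definition hypersurface :: "(complex^'k) set \<Rightarrow> bool" where
  "hypersurface V \<longleftrightarrow> (\<exists>f\<in>polyfuns. (\<nexists>c. f = (\<lambda>_. c)) \<and> V = {x. f x = 0})"

text \<open>A point of \<open>complex^('k + 'k)\<close> parametrizes the affine line through the point given by its
  \<open>Inl\<close> half in the direction given by its \<open>Inr\<close> half; a zero direction gives a single point.\<close>

definition line_point :: "complex^('k + 'k) \<Rightarrow> complex^'k" where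
  "line_point z = (\<chi> i. z $ Inl i)"

definition line_dir :: "complex^('k + 'k) \<Rightarrow> complex^'k" where
  "line_dir z = (\<chi> i. z $ Inr i)"

definition cline :: "complex^('k + 'k) \<Rightarrow> (complex^'k) set" where
  "cline z = range (\<lambda>t. line_point z + t *s line_dir z)"

text \<open>Since affine space is irreducible, a nonempty Zariski open set of parameters is dense, so at most one
  \<open>D\<close> satisfies the following. Finiteness is required because \<open>card\<close> of an infinite set is 0.\<close>

definition has_degree :: "(complex^'k) set \<Rightarrow> nat \<Rightarrow> bool" where
  "has_degree V D \<longleftrightarrow> (\<exists>U. openin zariski U \<and> U \<noteq> {} \<and>
     (\<forall>z\<in>U. line_dir z \<noteq> 0 \<longrightarrow> finite (V \<inter> cline z) \<and> card (V \<inter> cline z) = D))"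

definition ctorus :: "(complex^'d) set" where
  "ctorus = {v. \<forall>k. v $ k \<noteq> 0}"

definition tmonom :: "int^'d \<Rightarrow> complex^'d \<Rightarrow> complex" where
  "tmonom a v = (\<Prod>k\<in>UNIV. (v $ k) powi (a $ k))"

definition lbeta :: "complex^'n \<Rightarrow> 'n \<Rightarrow> complex" where
  "lbeta b j = exp (- (\<i> * b $ j * of_real pi / 2))"

definition diag :: "('n \<Rightarrow> complex) \<Rightarrow> complex^'n^'n" where
  "diag f = (\<chi> i j. if i = j then f i else 0)"

definition lissajous_psi :: "int^'n^'d \<Rightarrow> complex^'n \<Rightarrow> complex^'d \<Rightarrow> complex^'n" where
  "lissajous_psi A b v = (\<chi> j. (1/2) *
     (lbeta b j * tmonom (column j A) v + inverse (lbeta b j) * tmonom (- column j A) v))"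

definition incidence :: "int^'n^'d \<Rightarrow> complex^'n \<Rightarrow> ((complex^'d) \<times> (complex^'d)) set" where
  "incidence A b = {(v, w). v \<in> ctorus \<and> map_matrix of_int A *v lissajous_psi A b v = w}"

definition toric_jacobi :: "int^'n^'d \<Rightarrow> complex^'n \<Rightarrow> complex^'d \<Rightarrow> complex^'d^'d" where
  "toric_jacobi A b v = (1/2) *\<^sub>R (map_matrix of_int A **
     diag (\<lambda>j. lbeta b j * tmonom (column j A) v - inverse (lbeta b j) * tmonom (- column j A) v) **
     transpose (map_matrix of_int A))"

definition ramification :: "int^'n^'d \<Rightarrow> complex^'n \<Rightarrow> ((complex^'d) \<times> (complex^'d)) set" where
  "ramification A b = {(v, w) \<in> incidence A b. det (toric_jacobi A b v) = 0}"

definition lissajous_disc :: "int^'n^'d \<Rightarrow> complex^'n \<Rightarrow> (complex^'d) set" where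
  "lissajous_disc A b = zariski closure_of (snd ` ramification A b)"

text \<open>\<open>\<delta>\<close> is the degree of the projection from the ramification locus to the discriminant. As
  \<open>\<delta>\<close> is positive, the equation for \<open>card\<close> includes finiteness of the fiber. The discriminant
  may be reducible, so \<open>U\<close> has to be dense, not merely nonempty.\<close>

definition ramification_degree :: "int^'n^'d \<Rightarrow> complex^'n \<Rightarrow> nat \<Rightarrow> bool" where
  "ramification_degree A b \<delta> \<longleftrightarrow> \<delta> > 0 \<and>
     (\<exists>U. openin (subtopology zariski (lissajous_disc A b)) U \<and>
          subtopology zariski (lissajous_disc A b) closure_of U = lissajous_disc A b \<and>
          (\<forall>w\<in>U. card {v. (v, w) \<in> ramification A b} = \<delta>))"

definition lissajous_polytope :: "int^'n^'d \<Rightarrow> (real^'d) set" where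
  "lissajous_polytope A =
     convex hull (range (\<lambda>j. column j (map_matrix real_of_int A)) \<union> range (\<lambda>j. - column j (map_matrix real_of_int A)))"

end

theory Submission
  imports Defs "HOL-Computational_Algebra.Fundamental_Theorem_Algebra"
begin

text \<open>The bound is obtained by comparing dimensions, without Bernstein's theorem. Write \<open>h\<close> for the
  determinant of the toric Jacobi matrix, a Laurent polynomial supported in \<open>d P\<close>, and let a line
  with direction \<open>q\<close> meet the discriminant in the generic number \<open>D\<close> of points. Choose affine
  coordinates \<open>(t, y)\<close> in which the line is given by \<open>y = 0\<close>, and a linear form \<open>\<theta>\<close> on the torus that is
  injective on enough fibres of the projection. On the one hand, the functions
  \<open>\<theta>^i t^j y^\<mu>\<close> with \<open>i < \<delta>\<close>, \<open>j < D\<close> and \<open>|\<mu>| \<le> K\<close>, pulled back to the torus, are linearly independent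
  modulo functions vanishing on \<open>{h = 0}\<close>: fixing a point of the discriminant leaves a polynomial of
  degree less than \<open>\<delta>\<close> in \<open>\<theta>\<close> with \<open>\<delta>\<close> roots, and fixing \<open>y\<close> leaves a polynomial of degree less than \<open>D\<close>
  in \<open>t\<close> with \<open>D\<close> roots. On the other hand, they are supported in \<open>n P\<close> for \<open>n = K + const\<close>, which also
  contains the supports of the products of \<open>h\<close> with the monomials from \<open>(n - d) P\<close>. Hence the numbers
  \<open>N n\<close> of lattice points of \<open>n P\<close> satisfy
  \<open>N n - N (n - d) \<ge> \<delta> D K^(d - 1) / (d - 1)!\<close>. Summing over \<open>n\<close> in an arithmetic progression with
  difference \<open>d\<close> and using \<open>N n \<le> (n + C)^d vol P\<close> gives the claim as \<open>n\<close> tends to infinity.\<close>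

section \<open>Polynomial functions on lines\<close>

lemma polyfuns_uminus: "f \<in> polyfuns \<Longrightarrow> (\<lambda>x. - f x) \<in> polyfuns"
  using polyfuns.mult[OF polyfuns.const[of "-1"]] by simp

lemma polyfuns_diff: "f \<in> polyfuns \<Longrightarrow> g \<in> polyfuns \<Longrightarrow> (\<lambda>x. f x - g x) \<in> polyfuns"
  using polyfuns.add[OF _ polyfuns_uminus, of f g] by simp

lemma polyfuns_sum: "(\<And>i. i \<in> I \<Longrightarrow> f i \<in> polyfuns) \<Longrightarrow> (\<lambda>x. \<Sum>i\<in>I. f i x) \<in> polyfuns"
  by (induction I rule: infinite_finite_induct) (auto intro!: polyfuns.const polyfuns.add)

lemma polyfuns_prod: "(\<And>i. i \<in> I \<Longrightarrow> f i \<in> polyfuns) \<Longrightarrow> (\<lambda>x. \<Prod>i\<in>I. f i x) \<in> polyfuns"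
  by (induction I rule: infinite_finite_induct) (auto intro!: polyfuns.const polyfuns.mult)

lemma polyfuns_power: "f \<in> polyfuns \<Longrightarrow> (\<lambda>x. f x ^ n) \<in> polyfuns"
  by (induction n) (auto intro!: polyfuns.const polyfuns.mult)

lemma polyfuns_if: "(P \<Longrightarrow> f \<in> polyfuns) \<Longrightarrow> (\<lambda>x. if P then f x else 0) \<in> polyfuns"
  using polyfuns.const by (cases P) auto

lemmas polyfuns_intros = polyfuns.intros polyfuns_uminus polyfuns_diff polyfuns_sum polyfuns_prod
  polyfuns_power polyfuns_if

lemma polyfuns_compose:
  assumes "f \<in> polyfuns" and "\<And>i. (\<lambda>x. h x $ i) \<in> polyfuns"
  shows "(\<lambda>x. f (h x)) \<in> polyfuns"
  using assms(1) by induction (auto intro!: polyfuns_intros assms(2))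

text \<open>Induction on the construction of \<open>f\<close>, with the Cauchy product for products.
  Polynomial dependence of the coefficients on the line is what turns conditions on the restriction
  into Zariski open conditions on \<open>z\<close>.\<close>

lemma polyfun_on_lines:
  fixes f :: "complex^'k \<Rightarrow> complex"
  assumes "f \<in> polyfuns"
  shows "\<exists>(m::nat) c. (\<forall>j. c j \<in> polyfuns) \<and>
    (\<forall>z t. f (line_point z + t *s line_dir z) = (\<Sum>j\<le>m. c j z * t ^ j))"
  using assms
proof induction
  case (const c)
  show ?case
    by (rule exI[of _ 0], rule exI[of _ "\<lambda>_ _. c"]) (auto intro: polyfuns_intros)
next
  case (coord i)
  show ?case
    by (rule exI[of _ 1], rule exI[of _ "\<lambda>j. if j = 0 then (\<lambda>z. z $ Inl i) else (\<lambda>z. z $ Inr i)"])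
      (auto simp: line_point_def line_dir_def mult.commute if_distrib[of "\<lambda>g. g \<in> polyfuns"]
        intro: polyfuns.coord)
next
  case (add f g)
  then obtain m n c e where
    c: "\<And>j. c j \<in> polyfuns" "\<And>z t. f (line_point z + t *s line_dir z) = (\<Sum>j\<le>m. c j z * t ^ j)" and
    e: "\<And>j. e j \<in> polyfuns" "\<And>z t. g (line_point z + t *s line_dir z) = (\<Sum>j\<le>n. e j z * t ^ j)"
    by blast
  let ?c = "\<lambda>j z. (if j \<le> m then c j z else 0) + (if j \<le> n then e j z else 0)"
  have 1: "(\<Sum>j\<le>m. c j z * t ^ j) = (\<Sum>j\<le>max m n. (if j \<le> m then c j z else 0) * t ^ j)" for z t
    by (intro sum.mono_neutral_cong_left) auto
  have 2: "(\<Sum>j\<le>n. e j z * t ^ j) = (\<Sum>j\<le>max m n. (if j \<le> n then e j z else 0) * t ^ j)" for z t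
    by (intro sum.mono_neutral_cong_left) auto
  show ?case
  proof (rule exI[of _ "max m n"], rule exI[of _ ?c], intro conjI allI)
    show "?c j \<in> polyfuns" for j
      using c(1) e(1) by (intro polyfuns.add polyfuns_if)
  qed (simp add: c(2) e(2) 1 2 sum.distrib distrib_right)
next
  case (mult f g)
  then obtain m n c e where
    c: "\<And>j. c j \<in> polyfuns" "\<And>z t. f (line_point z + t *s line_dir z) = (\<Sum>j\<le>m. c j z * t ^ j)" and
    e: "\<And>j. e j \<in> polyfuns" "\<And>z t. g (line_point z + t *s line_dir z) = (\<Sum>j\<le>n. e j z * t ^ j)"
    by blast
  let ?S = "\<lambda>l. {(i,j). i \<le> m \<and> j \<le> n \<and> i + j = l}"
  let ?c = "\<lambda>l z. \<Sum>(i,j)\<in>?S l. c i z * e j z"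
  show ?case
  proof (rule exI[of _ "m + n"], rule exI[of _ ?c], intro conjI allI)
    show "?c l \<in> polyfuns" for l
      using c(1) e(1) by (auto intro!: polyfuns_intros simp: case_prod_unfold)
    fix z t
    have fin: "finite (?S l)" for l
      by (rule finite_subset[of _ "{..m} \<times> {..n}"]) auto
    have "f (line_point z + t *s line_dir z) * g (line_point z + t *s line_dir z)
      = (\<Sum>(i,j)\<in>{..m} \<times> {..n}. c i z * e j z * t ^ (i + j))"
      by (simp add: c(2) e(2) sum_product sum.cartesian_product power_add algebra_simps)
    also have "{..m} \<times> {..n} = (\<Union>l\<le>m+n. ?S l)"
      by auto
    also have "(\<Sum>(i,j)\<in>(\<Union>l\<le>m+n. ?S l). c i z * e j z * t ^ (i + j))
      = (\<Sum>l\<le>m+n. \<Sum>(i,j)\<in>?S l. c i z * e j z * t ^ (i + j))"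
      using fin by (intro sum.UNION_disjoint) auto
    also have "\<dots> = (\<Sum>l\<le>m+n. ?c l z * t ^ l)"
      by (intro sum.cong refl) (auto simp: sum_distrib_right intro!: sum.cong)
    finally show "f (line_point z + t *s line_dir z) * g (line_point z + t *s line_dir z)
      = (\<Sum>l\<le>m+n. ?c l z * t ^ l)" .
  qed
qed

definition line_param :: "complex^'k \<Rightarrow> complex^'k \<Rightarrow> complex^('k + 'k)" where
  "line_param p q = (\<chi> s. case s of Inl i \<Rightarrow> p $ i | Inr i \<Rightarrow> q $ i)"

lemma line_point_param [simp]: "line_point (line_param p q) = p"
  and line_dir_param [simp]: "line_dir (line_param p q) = q"
  by (simp_all add: line_param_def line_point_def line_dir_def)

lemma line_param_collapse: "line_param (line_point z) (line_dir z) = z"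
  by (simp add: line_param_def line_point_def line_dir_def vec_eq_iff split: sum.splits)

text \<open>For polynomial functions the choice is unambiguous, since a complex polynomial is
  determined by its values.\<close>

definition line_restrict :: "(complex^'k \<Rightarrow> complex) \<Rightarrow> complex^('k + 'k) \<Rightarrow> complex poly" where
  "line_restrict f z = (SOME P. \<forall>t. f (line_point z + t *s line_dir z) = poly P t)"

lemma poly_line_restrict:
  assumes "f \<in> polyfuns"
  shows "poly (line_restrict f z) t = f (line_point z + t *s line_dir z)"
proof -
  obtain m c where "\<And>t. f (line_point z + t *s line_dir z) = (\<Sum>j\<le>m. c j z * t ^ j)"
    using polyfun_on_lines[OF assms] by blast
  then have "\<exists>P. \<forall>t. f (line_point z + t *s line_dir z) = poly P t"
    by (intro exI[of _ "\<Sum>j\<le>m. monom (c j z) j"]) (simp add: poly_sum poly_monom)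
  from someI_ex[OF this, THEN spec, of t] show ?thesis
    unfolding line_restrict_def by (rule sym)
qed

text \<open>The degree bound \<open>m\<close> is uniform in the line; it later bounds the number of
  roots of all nonzero restrictions at once.\<close>

lemma coeff_line_restrict:
  assumes "f \<in> polyfuns"
  obtains m where "\<And>z. degree (line_restrict f z) \<le> m" "\<And>j. (\<lambda>z. coeff (line_restrict f z) j) \<in> polyfuns"
proof -
  obtain m c where c: "\<And>j. c j \<in> polyfuns"
    "\<And>z t. f (line_point z + t *s line_dir z) = (\<Sum>j\<le>m. c j z * t ^ j)"
    using polyfun_on_lines[OF assms] by blast
  have eq: "line_restrict f z = (\<Sum>j\<le>m. monom (c j z) j)" for z
    by (rule poly_ext) (simp add: poly_line_restrict[OF assms] c(2) poly_sum poly_monom)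
  have cf: "coeff (line_restrict f z) j = (if j \<le> m then c j z else 0)" for z j
    unfolding eq by (simp add: coeff_sum)
  have "degree (line_restrict f z) \<le> m" for z
    by (rule degree_le) (simp add: cf)
  moreover have "(\<lambda>z. coeff (line_restrict f z) j) \<in> polyfuns" for j
    unfolding cf by (intro polyfuns_if c(1))
  ultimately show ?thesis
    using that by blast
qed

text \<open>Restricting to the line through a point where \<open>f\<close> and a point where \<open>g\<close> does not vanish
  reduces this to univariate polynomials.\<close>

lemma polyfuns_mult_nonzero:
  assumes "f \<in> polyfuns" "g \<in> polyfuns" "f x \<noteq> 0" "g y \<noteq> 0"
  shows "\<exists>z. f z \<noteq> 0 \<and> g z \<noteq> 0"
proof -
  let ?z = "line_param x (y - x)"
  have "poly (line_restrict f ?z) 0 \<noteq> 0" "poly (line_restrict g ?z) 1 \<noteq> 0"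
    using assms by (simp_all add: poly_line_restrict)
  then have "line_restrict f ?z * line_restrict g ?z \<noteq> 0"
    by auto
  then obtain t where "poly (line_restrict f ?z * line_restrict g ?z) t \<noteq> 0"
    using poly_all_0_iff_0 by blast
  then have "poly (line_restrict f ?z) t \<noteq> 0 \<and> poly (line_restrict g ?z) t \<noteq> 0"
    by simp
  then show ?thesis
    unfolding poly_line_restrict[OF assms(1)] poly_line_restrict[OF assms(2)] by blast
qed

section \<open>Linear systems\<close>

text \<open>Gaussian elimination without division: \<open>\<Delta>\<close> is the product of the
  pivots, which are polynomials in \<open>z\<close> that do not vanish at \<open>z0\<close>.
  Independence of finitely many vectors thus persists on a Zariski open set.\<close>

lemma generic_independence:
  fixes m :: "nat \<Rightarrow> 'r \<Rightarrow> complex^'k \<Rightarrow> complex"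
  assumes "\<And>i r. i < a \<Longrightarrow> m i r \<in> polyfuns"
    and "\<And>c. (\<And>r. (\<Sum>i<a. c i * m i r z0) = 0) \<Longrightarrow> \<forall>i<a. c i = 0"
  shows "\<exists>\<Delta>\<in>polyfuns. \<Delta> z0 \<noteq> 0 \<and>
    (\<forall>z c. \<Delta> z \<noteq> 0 \<longrightarrow> (\<forall>r. (\<Sum>i<a. c i * m i r z) = 0) \<longrightarrow> (\<forall>i<a. c i = 0))"
  using assms
proof (induction a arbitrary: m)
  case 0
  show ?case
    by (rule bexI[of _ "\<lambda>_. 1"]) (auto intro: polyfuns_intros)
next
  case (Suc a)
  have "\<exists>r. m a r z0 \<noteq> 0"
  proof (rule ccontr)
    assume "\<not> ?thesis"
    then have "(\<Sum>i<Suc a. (if i = a then 1 else 0) * m i r z0) = 0" for r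
      by simp
    from Suc.prems(2)[OF this] show False by auto
  qed
  then obtain r0 where r0: "m a r0 z0 \<noteq> 0" by blast
  \<comment> \<open>Cross-multiplying with the pivot makes component \<open>r0\<close> of the first
    \<open>a\<close> vectors vanish while all entries stay polynomial.\<close>
  let ?m = "\<lambda>i r z. m a r0 z * m i r z - m i r0 z * m a r z"
  have eq: "(\<Sum>i<a. c i * ?m i r z) =
      m a r0 z * (\<Sum>i<a. c i * m i r z) - (\<Sum>i<a. c i * m i r0 z) * m a r z" for c r z
    by (simp add: sum_subtractf sum_distrib_left sum_distrib_right algebra_simps)
  have "\<exists>\<Delta>\<in>polyfuns. \<Delta> z0 \<noteq> 0 \<and>
    (\<forall>z c. \<Delta> z \<noteq> 0 \<longrightarrow> (\<forall>r. (\<Sum>i<a. c i * ?m i r z) = 0) \<longrightarrow> (\<forall>i<a. c i = 0))"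
  proof (rule Suc.IH)
    show "?m i r \<in> polyfuns" if "i < a" for i r
      using Suc.prems(1) that by (intro polyfuns_intros) auto
    fix c assume *: "\<And>r. (\<Sum>i<a. c i * ?m i r z0) = 0"
    \<comment> \<open>A relation between the reduced vectors lifts to one between all
      \<open>Suc a\<close> vectors; component \<open>r0\<close> dictates the last
      coefficient.\<close>
    let ?c = "\<lambda>i. if i < a then c i * m a r0 z0 else - (\<Sum>i<a. c i * m i r0 z0)"
    have "(\<Sum>i<Suc a. ?c i * m i r z0) = 0" for r
      using *[of r] unfolding eq by (simp add: sum_distrib_left algebra_simps)
    from Suc.prems(2)[OF this] show "\<forall>i<a. c i = 0"
      using r0 by (auto simp: less_Suc_eq)
  qed
  then obtain \<Delta> where \<Delta>: "\<Delta> \<in> polyfuns" "\<Delta> z0 \<noteq> 0" and ind: "\<And>z c. \<Delta> z \<noteq> 0 \<Longrightarrow>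
      (\<And>r. (\<Sum>i<a. c i * ?m i r z) = 0) \<Longrightarrow> (\<forall>i<a. c i = 0)"
    by blast
  show ?case
  proof (rule bexI[of _ "\<lambda>z. \<Delta> z * m a r0 z"], intro conjI allI impI)
    show "(\<lambda>z. \<Delta> z * m a r0 z) \<in> polyfuns"
      using \<Delta>(1) Suc.prems(1) by (intro polyfuns_intros) auto
    show "\<Delta> z0 * m a r0 z0 \<noteq> 0"
      using \<Delta>(2) r0 by simp
    fix z c i
    assume z: "\<Delta> z * m a r0 z \<noteq> 0" and 0: "\<forall>r. (\<Sum>i<Suc a. c i * m i r z) = 0" and i: "i < Suc a"
    have s: "(\<Sum>i<a. c i * m i r z) = - c a * m a r z" for r
      using 0[rule_format, of r] by (simp add: add_eq_0_iff2)
    have "(\<Sum>i<a. c i * ?m i r z) = 0" for r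
      unfolding eq s by simp
    from ind[OF _ this] z have "\<forall>i<a. c i = 0" by auto
    moreover from this have "c a * m a r0 z = 0"
      using 0[rule_format, of r0] by simp
    ultimately show "c i = 0"
      using i z by (auto simp: less_Suc_eq)
  qed
qed

text \<open>Induction on the equations: one with a nonzero coefficient is solved for its unknown
  \<open>i0\<close>, and substitution leaves one equation and one unknown fewer.\<close>

lemma homogeneous_system_nontrivial:
  fixes a :: "'i \<Rightarrow> 's \<Rightarrow> 'f::field"
  assumes "finite S" "finite I" "card S < card I"
  shows "\<exists>c. (\<exists>i\<in>I. c i \<noteq> 0) \<and> (\<forall>s\<in>S. (\<Sum>i\<in>I. c i * a i s) = 0)"
  using assms
proof (induction S arbitrary: I a)
  case empty
  then show ?case by (intro exI[of _ "\<lambda>_. 1"]) (auto simp: card_gt_0_iff)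
next
  case (insert s S)
  show ?case
  proof (cases "\<forall>i\<in>I. a i s = 0")
    case True
    then show ?thesis
      using insert.IH[of I a] insert by auto
  next
    case False
    then obtain i0 where i0: "i0 \<in> I" "a i0 s \<noteq> 0" by blast
    let ?J = "I - {i0}"
    let ?b = "\<lambda>i t. a i t - a i s / a i0 s * a i0 t"
    have "card S < card ?J" "finite ?J"
      using insert i0 by auto
    then obtain c where c: "\<exists>i\<in>?J. c i \<noteq> 0" "\<And>t. t \<in> S \<Longrightarrow> (\<Sum>i\<in>?J. c i * ?b i t) = 0"
      using insert.IH[of ?J ?b] by auto
    let ?c = "c(i0 := - (\<Sum>i\<in>?J. c i * a i s / a i0 s))"
    have eq: "(\<Sum>i\<in>I. ?c i * a i t) = (\<Sum>i\<in>?J. c i * ?b i t)" for t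
    proof -
      have "(\<Sum>i\<in>I. ?c i * a i t) = ?c i0 * a i0 t + (\<Sum>i\<in>?J. ?c i * a i t)"
        using i0 insert by (simp add: sum.remove)
      also have "(\<Sum>i\<in>?J. ?c i * a i t) = (\<Sum>i\<in>?J. c i * a i t)"
        by (intro sum.cong) auto
      also have "?c i0 * a i0 t + \<dots> = (\<Sum>i\<in>?J. c i * ?b i t)"
        by (simp add: sum_subtractf right_diff_distrib sum_distrib_right mult.assoc)
      finally show ?thesis .
    qed
    have "(\<Sum>i\<in>I. ?c i * a i t) = 0" if "t \<in> insert s S" for t
      unfolding eq using that c(2) i0 by (cases "t = s") auto
    moreover have "\<exists>i\<in>I. ?c i \<noteq> 0"
      using c(1) by auto
    ultimately show ?thesis by blast
  qed
qed

text \<open>Only finitely many conditions on the finite-dimensional space of coefficients can be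
  independent. The fibres over the points of \<open>S\<close> are the only ones that a linear form
  has to separate later.\<close>

lemma finite_vanishing_test:
  fixes \<phi> :: "'e \<Rightarrow> 'x \<Rightarrow> 'f::field"
  assumes "finite E"
  shows "\<exists>S\<subseteq>U. finite S \<and> (\<forall>c. (\<forall>x\<in>S. (\<Sum>e\<in>E. c e * \<phi> e x) = 0) \<longrightarrow> (\<forall>x\<in>U. (\<Sum>e\<in>E. c e * \<phi> e x) = 0))"
proof -
  define s where "s E c x = (\<Sum>e\<in>E. c e * \<phi> e x)" for E c x
  have "\<exists>S\<subseteq>U. finite S \<and> (\<forall>c. (\<forall>x\<in>S. s E c x = 0) \<longrightarrow> (\<forall>x\<in>U. s E c x = 0))"
    using assms
  proof induction
    case empty
    then show ?case by (auto simp: s_def)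
  next
    case (insert e0 E)
    let ?E = "insert e0 E"
    obtain S where S: "S \<subseteq> U" "finite S"
      and test: "\<forall>c. (\<forall>x\<in>S. s E c x = 0) \<longrightarrow> (\<forall>x\<in>U. s E c x = 0)"
      using insert.IH by (elim exE conjE)
    have sum: "s ?E c x = c e0 * \<phi> e0 x + s E c x" for c x
      using insert by (simp add: s_def)
    show ?case
    proof (cases "\<forall>c. (\<forall>x\<in>S. s ?E c x = 0) \<longrightarrow> (\<forall>x\<in>U. s ?E c x = 0)")
      case True
      then show ?thesis using S by (intro exI[of _ S] conjI)
    next
      case False
      then obtain c u where c: "\<And>x. x \<in> S \<Longrightarrow> s ?E c x = 0" and u: "u \<in> U" "s ?E c u \<noteq> 0"
        by blast
      have c0: "c e0 \<noteq> 0"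
        using spec[OF test, of c] c u by (auto simp: sum)
      have "s ?E b x = 0" if b: "\<forall>x\<in>insert u S. s ?E b x = 0" and x: "x \<in> U" for b x
      proof -
        \<comment> \<open>In this combination of \<open>b\<close> and \<open>c\<close> the term of
          \<open>e0\<close> cancels, so the test for \<open>E\<close> applies. At \<open>u\<close>,
          where the sum for \<open>b\<close> vanishes and that for \<open>c\<close> does not, it
          then forces \<open>b e0 = 0\<close>.\<close>
        define d where "d e = c e0 * b e - b e0 * c e" for e
        have d: "s E d x = c e0 * s ?E b x - b e0 * s ?E c x" for x
          unfolding sum by (simp add: d_def s_def sum_subtractf sum_distrib_left algebra_simps)
        have "\<forall>x\<in>S. s E d x = 0"
          unfolding d using b c by simp
        with test have z: "\<forall>x\<in>U. s E d x = 0" by (elim allE impE)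
        then have "b e0 * s ?E c u = 0"
          using u(1) b d[of u] by simp
        then have "b e0 = 0" using u by simp
        with z x c0 d[of x] show ?thesis by simp
      qed
      moreover have "insert u S \<subseteq> U" "finite (insert u S)"
        using S u(1) by auto
      ultimately show ?thesis
        by (intro exI[of _ "insert u S"] conjI allI impI ballI)
    qed
  qed
  then show ?thesis unfolding s_def .
qed

section \<open>The number of intersection points with a generic line\<close>

text \<open>The monic radical of a nonzero \<open>F\<close>. For \<open>F = 0\<close> the root set
  is infinite and the product defaults to 1.\<close>

definition sqfree_part :: "complex poly \<Rightarrow> complex poly" where
  "sqfree_part F = (\<Prod>r | poly F r = 0. [:-r, 1:])"

text \<open>The logarithmic derivative of \<open>F\<close> has only simple poles, located at the
  roots, and the radical clears them. The induction splits off one root.\<close>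

lemma sqfree_part_derivation:
  assumes "F \<noteq> 0"
  shows "F dvd sqfree_part F * pderiv F"
  using assms
proof (induction "degree F" arbitrary: F rule: less_induct)
  case (less F)
  show ?case
  proof (cases "degree F = 0")
    case True
    then obtain c where "F = [:c:]"
      using degree_eq_zeroE by blast
    then show ?thesis by (simp add: pderiv_pCons)
  next
    case False
    then obtain r where r: "poly F r = 0"
      using fundamental_theorem_of_algebra[of F] by (auto simp: constant_degree)
    then obtain G where G: "F = [:-r, 1:] * G"
      using poly_eq_0_iff_dvd[of F r] by (auto simp: dvd_def)
    with less.prems have G0: "G \<noteq> 0" by auto
    have fin: "finite {x. poly G x = 0}"
      using G0 by (rule poly_roots_finite)
    have "degree F = Suc (degree G)"
      using G0 degree_mult_eq[of "[:-r, 1:]" G] unfolding G by simp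
    then have "G dvd sqfree_part G * pderiv G"
      using less.hyps[OF _ G0] by simp
    then obtain B where B: "sqfree_part G * pderiv G = G * B"
      by (auto simp: dvd_def)
    define L where "L = [:-r, 1:]"
    have FL: "F = L * G" and F': "pderiv F = G + L * pderiv G"
      unfolding G L_def by (simp, subst pderiv_mult) (simp add: pderiv_pCons)
    have roots: "{x. poly F x = 0} = insert r {x. poly G x = 0}"
      unfolding G by (auto simp: algebra_simps)
    show ?thesis
    proof (cases "poly G r = 0")
      case True
      then have "sqfree_part F = sqfree_part G"
        unfolding sqfree_part_def roots by (simp add: insert_absorb)
      moreover have "sqfree_part G = L * (\<Prod>x\<in>{x. poly G x = 0} - {r}. [:-x, 1:])" (is "_ = _ * ?A")
        unfolding sqfree_part_def L_def using fin True by (simp add: prod.remove)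
      ultimately have "sqfree_part F * pderiv F = L * ?A * G + L * (sqfree_part G * pderiv G)"
        unfolding F' by (simp add: L_def[symmetric] algebra_simps)
      also have "\<dots> = F * (?A + B)"
        unfolding B FL by (simp add: algebra_simps)
      finally show ?thesis by (rule dvdI)
    next
      case False
      then have "sqfree_part F = L * sqfree_part G"
        unfolding sqfree_part_def roots L_def using fin by simp
      then have "sqfree_part F * pderiv F = L * sqfree_part G * G + L * L * (sqfree_part G * pderiv G)"
        unfolding F' by (simp add: L_def[symmetric] algebra_simps)
      also have "\<dots> = F * (sqfree_part G + L * B)"
        unfolding B FL by (simp add: algebra_simps)
      finally show ?thesis by (rule dvdI)
    qed
  qed
qed

lemma degree_sqfree_part: "degree (sqfree_part F) = card {r. poly F r = 0}"
  unfolding sqfree_part_def by (subst degree_prod_eq_sum_degree) auto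

lemma sqfree_part_nonzero: "sqfree_part F \<noteq> 0"
  unfolding sqfree_part_def by (cases "finite {r. poly F r = 0}") auto

text \<open>In characteristic 0 differentiation lowers the order of a root by exactly one, so
  \<open>A\<close> has to supply the missing factor.\<close>

lemma root_of_derivation_multiplier:
  fixes F :: "'a::field_char_0 poly"
  assumes "F \<noteq> 0" "A * pderiv F = B * F" "poly F r = 0"
  shows "poly A r = 0"
proof (cases "A = 0")
  case False
  have "order r F \<noteq> 0"
    using assms by (simp add: order_root)
  have d0: "pderiv F \<noteq> 0"
    using assms by (metis order_root order_0I pderiv_iszero poly_pCons poly_0 mult_zero_right add.right_neutral pCons_0_0)
  have nz: "A * pderiv F \<noteq> 0" using False d0 by simp
  have "order r F \<le> order r (A * pderiv F)"
    using nz assms(2) by (simp add: order_mult)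
  also have "\<dots> = order r A + order r (pderiv F)"
    using nz by (simp add: order_mult)
  finally have "order r A > 0"
    using order_pderiv[OF assms(1,3)] by simp
  then show ?thesis by (simp add: order_root)
qed simp

lemma sum_lessThan_add:
  fixes g :: "nat \<Rightarrow> 'a::comm_monoid_add"
  shows "(\<Sum>i<a + b. g i) = (\<Sum>i<a. g i) + (\<Sum>i<b. g (a + i))"
  by (induction b) (simp_all add: add.assoc)

text \<open>\<open>F\<close> has fewer than \<open>D\<close> roots iff \<open>A * pderiv F = B * F\<close> has a nontrivial solution with
  \<open>degree A < D\<close> and \<open>degree B < D - 1\<close>. This is a homogeneous linear system whose
  coefficients are polynomials in the parameters of the line.\<close>

lemma many_roots_open:
  fixes f :: "complex^'k \<Rightarrow> complex"
  assumes f: "f \<in> polyfuns" and nz: "line_restrict f z0 \<noteq> 0"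
    and D: "D \<le> card {t. poly (line_restrict f z0) t = 0}"
  shows "\<exists>\<Delta>\<in>polyfuns. \<Delta> z0 \<noteq> 0 \<and> (\<forall>z. \<Delta> z \<noteq> 0 \<longrightarrow> line_restrict f z \<noteq> 0 \<longrightarrow>
    D \<le> card {t. poly (line_restrict f z) t = 0})"
proof -
  define F where "F = line_restrict f"
  \<comment> \<open>Indices below \<open>D\<close> belong to the coefficients of \<open>A\<close>,
    the remaining \<open>D - 1\<close> to those of \<open>B\<close>; \<open>r\<close> numbers the
    coefficients of the equation. For \<open>D = 0\<close> truncated subtraction leaves no
    unknowns.\<close>
  define m where "m i r z = (if i < D then coeff (monom 1 i * pderiv (F z)) r
      else - coeff (monom 1 (i - D) * F z) r)" for i r z
  have sum_m: "(\<Sum>i<D + (D - 1). c i * m i r z) =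
      coeff ((\<Sum>i<D. monom (c i) i) * pderiv (F z) - (\<Sum>i<D - 1. monom (c (D + i)) i) * F z) r"
    for c r z
  proof -
    have "(\<Sum>i<D + (D - 1). c i * m i r z) = (\<Sum>i<D. c i * m i r z) + (\<Sum>i<D - 1. c (D + i) * m (D + i) r z)"
      by (rule sum_lessThan_add)
    also have "(\<Sum>i<D. c i * m i r z) = coeff ((\<Sum>i<D. monom (c i) i) * pderiv (F z)) r"
      unfolding sum_distrib_right coeff_sum by (intro sum.cong) (auto simp: m_def coeff_monom_mult)
    also have "(\<Sum>i<D - 1. c (D + i) * m (D + i) r z) = - coeff ((\<Sum>i<D - 1. monom (c (D + i)) i) * F z) r"
      unfolding sum_distrib_right coeff_sum sum_negf[symmetric]
      by (intro sum.cong) (auto simp: m_def coeff_monom_mult)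
    finally show ?thesis by simp
  qed
  have "\<exists>\<Delta>\<in>polyfuns. \<Delta> z0 \<noteq> 0 \<and> (\<forall>z c. \<Delta> z \<noteq> 0 \<longrightarrow> (\<forall>r. (\<Sum>i<D + (D - 1). c i * m i r z) = 0) \<longrightarrow>
      (\<forall>i<D + (D - 1). c i = 0))"
  proof (rule generic_independence)
    fix i r
    obtain n where "\<And>z. degree (line_restrict f z) \<le> n"
      and cf: "\<And>j. (\<lambda>z. coeff (F z) j) \<in> polyfuns"
      using coeff_line_restrict[OF f] unfolding F_def by blast
    have 1: "(\<lambda>z. coeff (monom 1 i * F z) r) \<in> polyfuns" for i r
      using cf by (cases "r < i") (auto simp: coeff_monom_mult intro: polyfuns_intros)
    have 2: "(\<lambda>z. coeff (monom 1 i * pderiv (F z)) r) \<in> polyfuns"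
      using polyfuns.mult[OF polyfuns.const cf] polyfuns.const
      by (cases "r < i") (auto simp: coeff_monom_mult coeff_pderiv)
    show "m i r \<in> polyfuns"
      using 2 polyfuns_uminus[OF 1, of "i - D" r] unfolding m_def by (cases "i < D") simp_all
  next
    fix c assume 0: "\<And>r. (\<Sum>i<D + (D - 1). c i * m i r z0) = 0"
    define A where "A = (\<Sum>i<D. monom (c i) i)"
    define B where "B = (\<Sum>i<D - 1. monom (c (D + i)) i)"
    have AB: "A * pderiv (F z0) = B * F z0"
      using 0 unfolding sum_m A_def B_def by (auto simp: poly_eq_iff)
    have cA: "coeff A i = (if i < D then c i else 0)" for i
      by (simp add: A_def coeff_sum)
    have cB: "coeff B i = (if i < D - 1 then c (D + i) else 0)" for i
      by (simp add: B_def coeff_sum)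
    \<comment> \<open>All roots of \<open>F z0\<close> are roots of \<open>A\<close>, too many for
      its degree.\<close>
    have "A = 0"
    proof (rule ccontr)
      assume A0: "A \<noteq> 0"
      have "D \<le> card {t. poly (F z0) t = 0}"
        using D by (simp add: F_def)
      also have "\<dots> \<le> card {t. poly A t = 0}"
        using A0 root_of_derivation_multiplier[OF _ AB] nz
        by (intro card_mono poly_roots_finite) (auto simp: F_def)
      also have "\<dots> \<le> degree A"
        using A0 by (rule card_poly_roots_bound)
      also have "\<dots> < D"
        using leading_coeff_neq_0[OF A0] unfolding cA by (auto split: if_splits)
      finally show False by simp
    qed
    with AB nz have "B = 0" by (auto simp: F_def)
    show "\<forall>i<D + (D - 1). c i = 0"
    proof (intro allI impI)
      fix i assume i: "i < D + (D - 1)"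
      show "c i = 0"
      proof (cases "i < D")
        case True
        then show ?thesis using cA[of i] \<open>A = 0\<close> by simp
      next
        case False
        then have "i - D < D - 1" "D + (i - D) = i" using i by linarith+
        then show ?thesis using cB[of "i - D"] \<open>B = 0\<close> by simp
      qed
    qed
  qed
  then obtain \<Delta> where \<Delta>: "\<Delta> \<in> polyfuns" "\<Delta> z0 \<noteq> 0" and
    inj: "\<And>z c. \<Delta> z \<noteq> 0 \<Longrightarrow> (\<forall>r. (\<Sum>i<D + (D - 1). c i * m i r z) = 0) \<Longrightarrow> (\<forall>i<D + (D - 1). c i = 0)"
    by blast
  have "D \<le> card {t. poly (F z) t = 0}" if z: "\<Delta> z \<noteq> 0" "F z \<noteq> 0" for z
  proof (rule ccontr)
    assume less: "\<not> ?thesis"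
    \<comment> \<open>With fewer than \<open>D\<close> roots the radical itself yields a nontrivial
      solution.\<close>
    define A where "A = sqfree_part (F z)"
    have A0: "A \<noteq> 0" and degA: "degree A < D"
      using less by (simp_all add: A_def sqfree_part_nonzero degree_sqfree_part)
    obtain B where AB: "A * pderiv (F z) = F z * B"
      using sqfree_part_derivation[OF z(2)] unfolding A_def by (auto simp: dvd_def)
    \<comment> \<open>A nonzero \<open>B\<close> has degree one less than \<open>A\<close>, because
      differentiation loses exactly one degree.\<close>
    have degB: "B = 0 \<or> degree B < D - 1"
    proof (cases "B = 0")
      case False
      then have 1: "A * pderiv (F z) \<noteq> 0"
        using z AB by simp
      then have P0: "pderiv (F z) \<noteq> 0"
        by auto
      then have "degree (F z) \<noteq> 0"
        by (simp add: pderiv_eq_0_iff)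
      moreover have "degree A + degree (pderiv (F z)) = degree (F z) + degree B"
        using degree_mult_eq[OF A0 P0] degree_mult_eq[OF z(2) False] AB by simp
      ultimately show ?thesis
        using degA unfolding degree_pderiv by linarith
    qed simp
    define c where "c i = (if i < D then coeff A i else coeff B (i - D))" for i
    have "(\<Sum>i<D. monom (c i) i) = A"
    proof (rule poly_eqI)
      show "coeff (\<Sum>i<D. monom (c i) i) i = coeff A i" for i
        using degA coeff_eq_0[of A i] by (simp add: coeff_sum c_def)
    qed
    moreover have "(\<Sum>i<D - 1. monom (c (D + i)) i) = B"
    proof (rule poly_eqI)
      show "coeff (\<Sum>i<D - 1. monom (c (D + i)) i) i = coeff B i" for i
        using degB coeff_eq_0[of B i] by (auto simp: coeff_sum c_def)
    qed
    ultimately have "\<forall>r. (\<Sum>i<D + (D - 1). c i * m i r z) = 0"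
      unfolding sum_m using AB by (simp add: mult.commute)
    from inj[OF z(1) this] have "c (degree A) = 0"
      using degA by simp
    with A0 degA show False by (simp add: c_def)
  qed
  with \<Delta> show ?thesis
    unfolding F_def by blast
qed

text \<open>Among the lines with base point off the zero set, the uniform degree bound gives one
  with the largest number of roots. \<open>many_roots_open\<close> makes this maximum the generic
  value.\<close>

lemma generic_line:
  fixes f :: "complex^'k \<Rightarrow> complex"
  assumes f: "f \<in> polyfuns" and nz: "f \<noteq> (\<lambda>_. 0)"
  obtains D z0 \<Delta> where "\<Delta> \<in> polyfuns" "\<Delta> z0 \<noteq> 0" "D > 0 \<Longrightarrow> line_dir z0 \<noteq> 0"
    "\<And>z. \<Delta> z \<noteq> 0 \<Longrightarrow> line_restrict f z \<noteq> 0 \<and> card {t. poly (line_restrict f z) t = 0} = D"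
proof -
  define N where "N z = card {t. poly (line_restrict f z) t = 0}" for z
  obtain x where x: "f x \<noteq> 0" using nz by blast
  obtain n where n: "\<And>z. degree (line_restrict f z) \<le> n"
    using coeff_line_restrict[OF f] by metis
  have F0: "line_restrict f z \<noteq> 0" if "f (line_point z) \<noteq> 0" for z
  proof
    assume "line_restrict f z = 0"
    then show False
      using poly_line_restrict[OF f, of z 0] that by simp
  qed
  have bound: "N z < Suc n" if "f (line_point z) \<noteq> 0" for z
    using card_poly_roots_bound[OF F0[OF that]] n[of z] unfolding N_def by linarith
  have "\<exists>z0. f (line_point z0) \<noteq> 0 \<and> (\<forall>z. f (line_point z) \<noteq> 0 \<longrightarrow> N z \<le> N z0)"
  proof (rule ex_has_greatest_nat[where b = "Suc n"])
    show "f (line_point (line_param x 0)) \<noteq> 0" using x by simp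
  qed (simp add: bound)
  then obtain z0 where z0: "f (line_point z0) \<noteq> 0"
    and max: "\<And>z. f (line_point z) \<noteq> 0 \<Longrightarrow> N z \<le> N z0"
    by blast
  obtain \<Delta> where \<Delta>: "\<Delta> \<in> polyfuns" "\<Delta> z0 \<noteq> 0"
    and open': "\<And>z. \<Delta> z \<noteq> 0 \<Longrightarrow> line_restrict f z \<noteq> 0 \<Longrightarrow> N z0 \<le> N z"
    using many_roots_open[OF f F0[OF z0] order.refl] unfolding N_def by blast
  have fp: "(\<lambda>z. f (line_point z)) \<in> polyfuns"
    by (intro polyfuns_compose[OF f]) (simp add: line_point_def polyfuns.coord)
  show thesis
  proof (rule that[of "\<lambda>z. \<Delta> z * f (line_point z)" z0 "N z0"])
    show "(\<lambda>z. \<Delta> z * f (line_point z)) \<in> polyfuns"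
      using \<Delta>(1) fp by (rule polyfuns.mult)
    show "\<Delta> z0 * f (line_point z0) \<noteq> 0"
      using \<Delta>(2) z0 by simp
    \<comment> \<open>A zero direction would make the restriction a nonzero constant, which has no
      roots.\<close>
    show "line_dir z0 \<noteq> 0" if "N z0 > 0"
    proof
      assume "line_dir z0 = 0"
      then have "{t. poly (line_restrict f z0) t = 0} = {}"
        using z0 unfolding poly_line_restrict[OF f] by simp
      with that show False by (simp add: N_def)
    qed
    show "line_restrict f z \<noteq> 0 \<and> card {t. poly (line_restrict f z) t = 0} = N z0" if "\<Delta> z * f (line_point z) \<noteq> 0" for z
      using that F0 max open' unfolding N_def[symmetric] by (simp add: order.antisym)
  qed
qed

text \<open>A line with nonzero direction is parametrized injectively, so roots of the restriction
  correspond to intersection points.\<close>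

lemma has_degree_generic_line:
  fixes f :: "complex^'k \<Rightarrow> complex"
  assumes f: "f \<in> polyfuns" and "\<Delta> \<in> polyfuns" "\<Delta> z0 \<noteq> 0"
    and D: "\<And>z. \<Delta> z \<noteq> 0 \<Longrightarrow> line_restrict f z \<noteq> 0 \<and> card {t. poly (line_restrict f z) t = 0} = D"
  shows "has_degree {x. f x = 0} D"
  unfolding has_degree_def
proof (intro exI conjI ballI impI)
  show "openin zariski (- zero_locus {\<Delta>})"
    using assms(2) by (auto simp: openin_zariski)
  show "- zero_locus {\<Delta>} \<noteq> {}"
    using assms(3) by (auto simp: zero_locus_def)
  fix z :: "complex^('k + 'k)"
  assume z: "z \<in> - zero_locus {\<Delta>}" and dir: "line_dir z \<noteq> 0"
  let ?g = "\<lambda>t. line_point z + t *s line_dir z" and ?R = "{t. poly (line_restrict f z) t = 0}"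
  have eq: "{x. f x = 0} \<inter> cline z = ?g ` ?R"
    by (auto simp: cline_def poly_line_restrict[OF f])
  have "inj ?g"
    using dir by (auto intro!: injI simp: vec_eq_iff)
  then have "card (?g ` ?R) = card ?R"
    by (intro card_image) (auto intro: inj_on_subset)
  moreover have "finite ?R" "card ?R = D"
    using D[of z] z by (auto simp: zero_locus_def intro: poly_roots_finite)
  ultimately show "finite ({x. f x = 0} \<inter> cline z)" "card ({x. f x = 0} \<inter> cline z) = D"
    unfolding eq by auto
qed

section \<open>Laurent polynomials\<close>

lemma tmonom_nonzero: "v \<in> ctorus \<Longrightarrow> tmonom m v \<noteq> 0"
  by (simp add: tmonom_def ctorus_def)

lemma tmonom_add: "v \<in> ctorus \<Longrightarrow> tmonom (m + n) v = tmonom m v * tmonom n v"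
  by (simp add: tmonom_def ctorus_def power_int_add prod.distrib)

lemma tmonom_mult_arg: "tmonom m (v * w) = tmonom m v * tmonom m w"
  by (simp add: tmonom_def power_int_mult_distrib prod.distrib)

lemma tmonom_zero [simp]: "tmonom 0 v = 1"
  by (simp add: tmonom_def)

lemma tmonom_one [simp]: "tmonom m 1 = 1"
  by (simp add: tmonom_def)

lemma ctorus_mult: "v \<in> ctorus \<Longrightarrow> w \<in> ctorus \<Longrightarrow> v * w \<in> ctorus"
  by (simp add: ctorus_def)

lemma one_in_ctorus [simp]: "1 \<in> ctorus"
  by (simp add: ctorus_def)

lemma tmonom_separates:
  fixes m n :: "int^'d"
  assumes "m \<noteq> n"
  shows "\<exists>v\<in>ctorus. tmonom m v \<noteq> tmonom n v"
proof -
  obtain k where k: "m $ k \<noteq> n $ k"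
    using assms by (auto simp: vec_eq_iff)
  let ?v = "(\<chi> i. if i = k then 2 else 1) :: complex^'d"
  have eq: "tmonom m ?v = of_real (2 powi (m $ k))" for m :: "int^'d"
  proof -
    have "tmonom m ?v = (\<Prod>i\<in>UNIV. if i = k then 2 powi (m $ k) else 1)"
      unfolding tmonom_def by (intro prod.cong) auto
    then show ?thesis by (simp add: of_real_power_int)
  qed
  have "(2::real) powi (m $ k) \<noteq> 2 powi (n $ k)"
    using k power_int_strict_increasing[of "m $ k" "n $ k" "2::real"]
      power_int_strict_increasing[of "n $ k" "m $ k" "2::real"] by (cases "m $ k < n $ k") auto
  then have "tmonom m ?v \<noteq> tmonom n ?v"
    unfolding eq of_real_eq_iff .
  moreover have "?v \<in> ctorus"
    by (simp add: ctorus_def)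
  ultimately show ?thesis by blast
qed

text \<open>Dedekind's argument: translating by a point that separates two characters eliminates one of them.\<close>

lemma tmonom_independent:
  assumes "finite M" "\<And>v. v \<in> ctorus \<Longrightarrow> (\<Sum>m\<in>M. c m * tmonom m v) = 0" "m \<in> M"
  shows "c m = 0"
  using assms
proof (induction M arbitrary: c m)
  case (insert m0 M)
  have rest: "c m1 = 0" if m1: "m1 \<in> M" for m1
  proof -
    have "m0 \<noteq> m1" using insert m1 by auto
    then obtain u where u: "u \<in> ctorus" "tmonom m0 u \<noteq> tmonom m1 u"
      using tmonom_separates by blast
    have "c m1 * (tmonom m1 u - tmonom m0 u) = 0"
    proof (rule insert.IH[OF _ m1])
      fix v :: "complex^'a" assume v: "v \<in> ctorus"
      have "(\<Sum>m\<in>M. c m * (tmonom m u - tmonom m0 u) * tmonom m v) =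
        (\<Sum>m\<in>insert m0 M. c m * tmonom m (u * v)) - tmonom m0 u * (\<Sum>m\<in>insert m0 M. c m * tmonom m v)"
        using insert.hyps by (simp add: tmonom_mult_arg sum_subtractf sum_distrib_left algebra_simps)
      also have "\<dots> = 0"
        using insert.prems(1)[OF v] insert.prems(1)[OF ctorus_mult[OF u(1) v]] by simp
      finally show "(\<Sum>m\<in>M. c m * (tmonom m u - tmonom m0 u) * tmonom m v) = 0" .
    qed
    with u show ?thesis by simp
  qed
  have "c m0 = 0"
    using insert.prems(1)[of 1] rest insert.hyps by simp
  with rest insert.prems(2) show ?case by auto
qed simp

text \<open>Only the values on the torus are prescribed, and \<open>M\<close> merely bounds the
  support: coefficients may be zero.\<close>

definition laurent :: "(int^'d) set \<Rightarrow> (complex^'d \<Rightarrow> complex) set" where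
  "laurent M = {f. \<exists>c. \<forall>v\<in>ctorus. f v = (\<Sum>m\<in>M. c m * tmonom m v)}"

lemma laurentI: "(\<And>v. v \<in> ctorus \<Longrightarrow> f v = (\<Sum>m\<in>M. c m * tmonom m v)) \<Longrightarrow> f \<in> laurent M"
  unfolding laurent_def by blast

lemma laurentD: "f \<in> laurent M \<Longrightarrow> \<exists>c. \<forall>v\<in>ctorus. f v = (\<Sum>m\<in>M. c m * tmonom m v)"
  unfolding laurent_def by blast

lemma laurent_monom:
  assumes "finite M" "m \<in> M"
  shows "(\<lambda>v. c * tmonom m v) \<in> laurent M"
  by (rule laurentI[where c = "\<lambda>n. if n = m then c else 0"])
    (use assms in \<open>simp add: if_distrib[of "\<lambda>x. x * _"] cong: if_cong\<close>)

lemma laurent_mono: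
  assumes "f \<in> laurent M" "M \<subseteq> N" "finite N"
  shows "f \<in> laurent N"
proof -
  obtain c where c: "\<And>v. v \<in> ctorus \<Longrightarrow> f v = (\<Sum>m\<in>M. c m * tmonom m v)"
    using laurentD[OF assms(1)] by blast
  show ?thesis
  proof (rule laurentI)
    fix v :: "complex^'a" assume "v \<in> ctorus"
    then have "f v = (\<Sum>m\<in>M. c m * tmonom m v)" by (rule c)
    also have "\<dots> = (\<Sum>m\<in>N. (if m \<in> M then c m else 0) * tmonom m v)"
      using assms(2,3) by (intro sum.mono_neutral_cong_left) auto
    finally show "f v = \<dots>" .
  qed
qed

lemma laurent_add:
  assumes "f \<in> laurent M" "g \<in> laurent M"
  shows "(\<lambda>v. f v + g v) \<in> laurent M"
proof -
  obtain c where "\<And>v. v \<in> ctorus \<Longrightarrow> f v = (\<Sum>m\<in>M. c m * tmonom m v)"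
    using laurentD[OF assms(1)] by blast
  moreover obtain e where "\<And>v. v \<in> ctorus \<Longrightarrow> g v = (\<Sum>m\<in>M. e m * tmonom m v)"
    using laurentD[OF assms(2)] by blast
  ultimately show ?thesis
    by (intro laurentI[where c = "\<lambda>m. c m + e m"]) (simp add: sum.distrib distrib_right)
qed

lemma laurent_mult:
  assumes f: "f \<in> laurent M" and g: "g \<in> laurent N"
    and fin: "finite M" "finite N" "finite K" and sub: "\<And>m n. m \<in> M \<Longrightarrow> n \<in> N \<Longrightarrow> m + n \<in> K"
  shows "(\<lambda>v. f v * g v) \<in> laurent K"
proof -
  obtain c where c: "\<And>v. v \<in> ctorus \<Longrightarrow> f v = (\<Sum>m\<in>M. c m * tmonom m v)"
    using laurentD[OF f] by blast
  obtain e where e: "\<And>v. v \<in> ctorus \<Longrightarrow> g v = (\<Sum>m\<in>N. e m * tmonom m v)"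
    using laurentD[OF g] by blast
  define b where "b k = (\<Sum>(m, n) | (m, n) \<in> M \<times> N \<and> m + n = k. c m * e n)" for k
  show ?thesis
  proof (rule laurentI)
    fix v :: "complex^'a" assume v: "v \<in> ctorus"
    have "f v * g v = (\<Sum>p\<in>M \<times> N. c (fst p) * e (snd p) * tmonom (fst p + snd p) v)"
      by (simp add: c[OF v] e[OF v] sum_product sum.cartesian_product tmonom_add[OF v] case_prod_unfold mult_ac)
    also have "\<dots> = (\<Sum>k\<in>K. \<Sum>p | p \<in> M \<times> N \<and> fst p + snd p = k. c (fst p) * e (snd p) * tmonom (fst p + snd p) v)"
      using fin sub by (intro sum.group[symmetric]) auto
    also have "\<dots> = (\<Sum>k\<in>K. b k * tmonom k v)"
      unfolding b_def sum_distrib_right by (intro sum.cong) (auto simp: case_prod_unfold)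
    finally show "f v * g v = (\<Sum>k\<in>K. b k * tmonom k v)" .
  qed
qed

text \<open>Otherwise the homogeneous system with one equation for each monomial in \<open>M\<close>
  has a nontrivial solution, which is a relation between the functions.\<close>

lemma card_independent_laurent_le:
  fixes g :: "'i \<Rightarrow> complex^'d \<Rightarrow> complex"
  assumes "finite M" "finite I" and g: "\<And>i. i \<in> I \<Longrightarrow> g i \<in> laurent M"
    and indep: "\<And>c. (\<And>v. v \<in> ctorus \<Longrightarrow> (\<Sum>i\<in>I. c i * g i v) = 0) \<Longrightarrow> \<forall>i\<in>I. c i = 0"
  shows "card I \<le> card M"
proof (rule ccontr)
  assume less: "\<not> ?thesis"
  have "\<forall>i\<in>I. \<exists>a. \<forall>v\<in>ctorus. g i v = (\<Sum>m\<in>M. a m * tmonom m v)"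
    using g unfolding laurent_def by blast
  from bchoice[OF this] obtain a
    where a: "\<And>i v. i \<in> I \<Longrightarrow> v \<in> ctorus \<Longrightarrow> g i v = (\<Sum>m\<in>M. a i m * tmonom m v)" by blast
  obtain c where c: "\<exists>i\<in>I. c i \<noteq> 0" "\<And>m. m \<in> M \<Longrightarrow> (\<Sum>i\<in>I. c i * a i m) = 0"
    using homogeneous_system_nontrivial[of M I a] assms(1,2) less by auto
  have "(\<Sum>i\<in>I. c i * g i v) = 0" if v: "v \<in> ctorus" for v
  proof -
    have "(\<Sum>i\<in>I. c i * g i v) = (\<Sum>i\<in>I. \<Sum>m\<in>M. c i * a i m * tmonom m v)"
      by (intro sum.cong refl) (simp add: a[OF _ v] sum_distrib_left mult.assoc)
    also have "\<dots> = (\<Sum>m\<in>M. (\<Sum>i\<in>I. c i * a i m) * tmonom m v)"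
      by (subst sum.swap) (simp add: sum_distrib_right)
    finally show ?thesis by (simp add: c(2))
  qed
  from indep[OF this] c(1) show False by blast
qed

text \<open>Multiplication by a monomial with large exponents, which has no zeros on the torus,
  makes all exponents nonnegative.\<close>

lemma laurent_clear_denominators:
  fixes f :: "complex^'d \<Rightarrow> complex"
  assumes "finite M" "f \<in> laurent M"
  shows "\<exists>p\<in>polyfuns. \<forall>v\<in>ctorus. p v = 0 \<longleftrightarrow> f v = 0"
proof -
  obtain c where c: "\<And>v. v \<in> ctorus \<Longrightarrow> f v = (\<Sum>m\<in>M. c m * tmonom m v)"
    using laurentD[OF assms(2)] by blast
  define N :: "int^'d" where "N = (\<chi> k. \<Sum>m\<in>M. \<bar>m $ k\<bar>)"
  define p where "p = (\<lambda>v::complex^'d. \<Sum>m\<in>M. c m * (\<Prod>k\<in>UNIV. v $ k ^ nat (m $ k + N $ k)))"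
  have nonneg: "m $ k + N $ k \<ge> 0" if "m \<in> M" for m k
    using member_le_sum[OF that, of "\<lambda>m. \<bar>m $ k\<bar>"] assms(1) abs_ge_minus_self[of "m $ k"]
    unfolding N_def by simp
  have eq: "p v = f v * tmonom N v" if v: "v \<in> ctorus" for v
  proof -
    have "(\<Prod>k\<in>UNIV. v $ k ^ nat (m $ k + N $ k)) = tmonom m v * tmonom N v" if "m \<in> M" for m
      unfolding tmonom_add[OF v, symmetric] using nonneg[OF that] by (simp add: tmonom_def power_int_def)
    then show ?thesis
      unfolding p_def c[OF v] sum_distrib_right by (intro sum.cong) auto
  qed
  show ?thesis
  proof (intro bexI[of _ p] ballI)
    show "p \<in> polyfuns"
      unfolding p_def by (intro polyfuns_intros)
    show "p v = 0 \<longleftrightarrow> f v = 0" if "v \<in> ctorus" for v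
      using eq[OF that] tmonom_nonzero[OF that] by simp
  qed
qed

text \<open>Reduction to polynomials; the product of all coordinates joins as a factor to keep the
  common nonzero point inside the torus.\<close>

lemma laurent_mult_nonzero:
  fixes f g :: "complex^'d \<Rightarrow> complex"
  assumes "finite M" "finite N" "f \<in> laurent M" "g \<in> laurent N"
    and "v \<in> ctorus" "f v \<noteq> 0" "w \<in> ctorus" "g w \<noteq> 0"
  shows "\<exists>u\<in>ctorus. f u \<noteq> 0 \<and> g u \<noteq> 0"
proof -
  obtain p where p: "p \<in> polyfuns" "\<And>v. v \<in> ctorus \<Longrightarrow> p v = 0 \<longleftrightarrow> f v = 0"
    using laurent_clear_denominators[OF assms(1,3)] by blast
  obtain q where q: "q \<in> polyfuns" "\<And>v. v \<in> ctorus \<Longrightarrow> q v = 0 \<longleftrightarrow> g v = 0"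
    using laurent_clear_denominators[OF assms(2,4)] by blast
  let ?t = "\<lambda>x::complex^'d. \<Prod>k\<in>UNIV. x $ k"
  have t: "?t x \<noteq> 0 \<longleftrightarrow> x \<in> ctorus" for x
    by (simp add: ctorus_def)
  have tp: "?t \<in> polyfuns" and qt: "(\<lambda>x. q x * ?t x) \<in> polyfuns"
    using q(1) by (intro polyfuns_intros)+
  have "p v \<noteq> 0" "q w \<noteq> 0" "?t w \<noteq> 0"
    using assms p(2) q(2) t by auto
  then obtain u where "p u \<noteq> 0" "q u * ?t u \<noteq> 0"
    using polyfuns_mult_nonzero[OF p(1) qt, of v w] by auto
  then show ?thesis
    using t[of u] p(2) q(2) by auto
qed

section \<open>Lattice points in dilated convex bodies\<close>

definition real_vec :: "int^'d \<Rightarrow> real^'d" where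
  "real_vec m = (\<chi> i. real_of_int (m $ i))"

lemma real_vec_nth [simp]: "real_vec m $ i = of_int (m $ i)"
  by (simp add: real_vec_def)

lemma real_vec_simps [simp]:
  "real_vec 0 = 0" "real_vec (m + n) = real_vec m + real_vec n" "real_vec (- m) = - real_vec m"
  "real_vec (m - n) = real_vec m - real_vec n"
  by (simp_all add: vec_eq_iff)

lemma real_vec_inject [simp]: "real_vec m = real_vec n \<longleftrightarrow> m = n"
  by (simp add: vec_eq_iff)

definition lattice_points :: "(real^'d) set \<Rightarrow> nat \<Rightarrow> (int^'d) set" where
  "lattice_points P k = {m. real_vec m \<in> (*\<^sub>R) (real k) ` P}"

lemma finite_bounded_int_vecs:
  fixes S :: "(real^'d) set"
  assumes "bounded S"
  shows "finite {m. real_vec m \<in> S}"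
proof -
  obtain B where B: "\<And>x. x \<in> S \<Longrightarrow> norm x \<le> B"
    using assms by (auto simp: bounded_iff)
  have "{m. real_vec m \<in> S} \<subseteq> (\<lambda>f. \<chi> i. f i) ` (UNIV \<rightarrow>\<^sub>E {- \<lceil>B\<rceil>..\<lceil>B\<rceil>})"
  proof
    fix m :: "int^'d" assume "m \<in> {m. real_vec m \<in> S}"
    then have m: "norm (real_vec m) \<le> B" using B by simp
    have "m $ i \<in> {- \<lceil>B\<rceil>..\<lceil>B\<rceil>}" for i
      using component_le_norm_cart[of "real_vec m" i] m by (simp add: abs_le_iff) linarith
    then show "m \<in> (\<lambda>f. \<chi> i. f i) ` (UNIV \<rightarrow>\<^sub>E {- \<lceil>B\<rceil>..\<lceil>B\<rceil>})"
      by (intro image_eqI[of _ _ "\<lambda>i. m $ i"]) auto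
  qed
  then show ?thesis
    by (rule finite_subset) (intro finite_imageI finite_PiE; simp)
qed

lemma finite_lattice_points: "bounded P \<Longrightarrow> finite (lattice_points P k)"
  unfolding lattice_points_def by (intro finite_bounded_int_vecs bounded_scaling)

text \<open>For nonzero \<open>a + c\<close> the sum is \<open>a + c\<close> times a convex
  combination with weights \<open>a / (a + c)\<close> and \<open>c / (a + c)\<close>.\<close>

lemma convex_scaled_sum:
  fixes x y :: "'a::real_vector"
  assumes "convex P" "0 \<le> a" "0 \<le> c" "x \<in> (*\<^sub>R) a ` P" "y \<in> (*\<^sub>R) c ` P"
  shows "x + y \<in> (*\<^sub>R) (a + c) ` P"
proof (cases "a + c = 0")
  case True
  then have "a = 0" "c = 0" using assms(2,3) by linarith+
  then show ?thesis using assms(4,5) by auto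
next
  case False
  from assms obtain p q where p: "p \<in> P" "x = a *\<^sub>R p" and q: "q \<in> P" "y = c *\<^sub>R q" by auto
  have "(a / (a + c)) *\<^sub>R p + (c / (a + c)) *\<^sub>R q \<in> P"
    using False assms p q by (intro convexD) (auto simp: add_divide_distrib[symmetric])
  moreover have "x + y = (a + c) *\<^sub>R ((a / (a + c)) *\<^sub>R p + (c / (a + c)) *\<^sub>R q)"
    using False by (simp add: p q scaleR_add_right)
  ultimately show ?thesis by blast
qed

lemma lattice_points_add:
  assumes "convex P" "m \<in> lattice_points P j" "n \<in> lattice_points P k"
  shows "m + n \<in> lattice_points P (j + k)"
  using convex_scaled_sum[OF assms(1), of "real j" "real k"] assms(2,3) by (simp add: lattice_points_def)

lemma lattice_points_mono:
  assumes "convex P" "0 \<in> P" "j \<le> k"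
  shows "lattice_points P j \<subseteq> lattice_points P k"
proof
  fix m assume "m \<in> lattice_points P j"
  moreover have "0 \<in> lattice_points P (k - j)"
    using assms(2) by (auto simp: lattice_points_def)
  ultimately have "m + 0 \<in> lattice_points P (j + (k - j))"
    by (rule lattice_points_add[OF assms(1)])
  with assms(3) show "m \<in> lattice_points P k" by simp
qed

text \<open>The translates of the open unit cube by the lattice points of \<open>k P\<close> are disjoint and
  contained in \<open>(k + C) P\<close>.\<close>

lemma card_lattice_points_le:
  fixes P :: "(real^'d) set"
  assumes "convex P" "compact P" and C: "C \<ge> 0" "box 0 1 \<subseteq> (*\<^sub>R) C ` P"
  shows "real (card (lattice_points P k)) \<le> (real k + C) ^ CARD('d) * measure lborel P"
proof -
  let ?L = "lattice_points P k" and ?Q = "(*\<^sub>R) (real k + C) ` P"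
  let ?B = "\<lambda>m. box (real_vec m) (real_vec m + 1)"
  have fin: "finite ?L"
    using assms(2) by (intro finite_lattice_points compact_imp_bounded)
  have disj: "?B m \<inter> ?B n = {}" if "m \<noteq> n" for m n :: "int^'d"
  proof (rule ccontr)
    assume "?B m \<inter> ?B n \<noteq> {}"
    then obtain x where x: "x \<in> ?B m" "x \<in> ?B n" by blast
    obtain i where i: "m $ i \<noteq> n $ i" using \<open>m \<noteq> n\<close> by (auto simp: vec_eq_iff)
    have "of_int (m $ i) < x $ i" "x $ i < of_int (m $ i) + 1"
      "of_int (n $ i) < x $ i" "x $ i < of_int (n $ i) + 1"
      using x by (simp_all add: mem_box_cart)
    with i show False by linarith
  qed
  have one: "(1::real^'d) \<bullet> b = 1" if "b \<in> Basis" for b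
    using that by (auto simp: Basis_vec_def inner_axis)
  have meas: "measure lebesgue (?B m) = 1" for m :: "int^'d"
    using one by (simp add: measure_lborel_box_eq inner_add_left)
  have sub: "?B m \<subseteq> ?Q" if "m \<in> ?L" for m
  proof
    fix x assume "x \<in> ?B m"
    then have "x - real_vec m \<in> box 0 1"
      by (auto simp: mem_box_cart algebra_simps)
    then have "x - real_vec m \<in> (*\<^sub>R) C ` P" using C by blast
    then show "x \<in> ?Q"
      using convex_scaled_sum[OF assms(1) _ C(1), of "real k" "real_vec m" "x - real_vec m"] that
      by (simp add: lattice_points_def)
  qed
  have "real (card ?L) = (\<Sum>m\<in>?L. measure lebesgue (?B m))"
    by (simp only: meas) simp
  also have "\<dots> = measure lebesgue (\<Union>m\<in>?L. ?B m)"
    using fin disj by (intro measure_finite_Union[symmetric])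
      (auto simp: disjoint_family_on_def fmeasurableD2)
  also have "\<dots> \<le> measure lebesgue ?Q"
  proof (rule measure_mono_fmeasurable)
    show "(\<Union>m\<in>?L. ?B m) \<subseteq> ?Q"
      using sub by blast
    show "(\<Union>m\<in>?L. ?B m) \<in> sets lebesgue"
      using fin by (intro sets.finite_UN) auto
    show "?Q \<in> lmeasurable"
      using assms(2) by (intro lmeasurable_compact compact_scaling)
  qed
  also have "\<dots> = (real k + C) ^ CARD('d) * measure lebesgue P"
    using C measure_lebesgue_affine[of "real k + C" 0 P] by simp
  also have "measure lebesgue P = measure lborel P"
    using assms(2) by (simp add: borel_compact)
  finally show ?thesis .
qed

section \<open>Nonsingular Gram matrices of monomials\<close>

text \<open>Finitely many hyperplanes form a null set.\<close>

lemma avoid_hyperplanes: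
  fixes U :: "'a::euclidean_space set"
  assumes "finite U" "0 \<notin> U"
  shows "\<exists>x. \<forall>u\<in>U. u \<bullet> x \<noteq> 0"
proof -
  have "negligible (\<Union>u\<in>U. {x. u \<bullet> x = 0})"
    using assms by (intro negligible_Union) (auto intro!: negligible_hyperplane)
  then have "(\<Union>u\<in>U. {x. u \<bullet> x = 0}) \<noteq> UNIV"
    by (metis non_negligible_UNIV)
  then show ?thesis by auto
qed

text \<open>Along the one-parameter subgroup \<open>exp_vec (s *\<^sub>R \<xi>)\<close> a monomial
  grows exponentially, at the rate given by the inner product of its exponent with
  \<open>\<xi>\<close>.\<close>

definition exp_vec :: "real^'d \<Rightarrow> complex^'d" where
  "exp_vec x = (\<chi> k. of_real (exp (x $ k)))"

lemma exp_vec_in_ctorus [simp]: "exp_vec x \<in> ctorus"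
  by (simp add: exp_vec_def ctorus_def)

lemma tmonom_exp_vec: "tmonom m (exp_vec x) = of_real (exp (x \<bullet> real_vec m))"
proof -
  have "tmonom m (exp_vec x) = (\<Prod>k\<in>UNIV. of_real (exp (x $ k * of_int (m $ k))))"
    unfolding tmonom_def
    by (intro prod.cong refl) (simp add: exp_vec_def exp_power_int mult.commute flip: of_real_power_int)
  also have "\<dots> = of_real (exp (\<Sum>k\<in>UNIV. x $ k * of_int (m $ k)))"
    by (simp add: exp_sum flip: of_real_prod)
  finally show ?thesis
    by (simp add: inner_vec_def)
qed

text \<open>On the torus, this is the matrix of logarithmic partial derivatives of the vector-valued
  Laurent polynomial with terms \<open>g m * tmonom m v\<close> times the vector
  \<open>m\<close>.\<close>

definition gram :: "(int^'d \<Rightarrow> complex) \<Rightarrow> (int^'d) set \<Rightarrow> complex^'d \<Rightarrow> complex^'d^'d" where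
  "gram g M v = (\<chi> i k. \<Sum>m\<in>M. g m * tmonom m v * of_int (m $ i) * of_int (m $ k))"

lemma gram_congruence:
  "(Y ** gram g M v ** transpose Y) $ i $ k =
    (\<Sum>m\<in>M. g m * tmonom m v * (\<Sum>p\<in>UNIV. Y $ i $ p * of_int (m $ p)) * (\<Sum>q\<in>UNIV. Y $ k $ q * of_int (m $ q)))"
proof -
  have "(Y ** gram g M v ** transpose Y) $ i $ k = (\<Sum>q\<in>UNIV. \<Sum>p\<in>UNIV. \<Sum>m\<in>M.
      Y $ i $ p * (g m * tmonom m v * of_int (m $ p) * of_int (m $ q)) * Y $ k $ q)"
    by (simp add: matrix_matrix_mult_def transpose_def gram_def sum_distrib_left sum_distrib_right)
  also have "\<dots> = (\<Sum>q\<in>UNIV. \<Sum>m\<in>M. \<Sum>p\<in>UNIV.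
      Y $ i $ p * (g m * tmonom m v * of_int (m $ p) * of_int (m $ q)) * Y $ k $ q)"
    by (intro sum.cong refl sum.swap)
  also have "\<dots> = (\<Sum>m\<in>M. \<Sum>q\<in>UNIV. \<Sum>p\<in>UNIV.
      Y $ i $ p * (g m * tmonom m v * of_int (m $ p) * of_int (m $ q)) * Y $ k $ q)"
    by (rule sum.swap)
  also have "\<dots> = (\<Sum>m\<in>M. \<Sum>p\<in>UNIV. \<Sum>q\<in>UNIV.
      Y $ i $ p * (g m * tmonom m v * of_int (m $ p) * of_int (m $ q)) * Y $ k $ q)"
    by (intro sum.cong refl sum.swap)
  also have "\<dots> = (\<Sum>m\<in>M. g m * tmonom m v * (\<Sum>p\<in>UNIV. Y $ i $ p * of_int (m $ p)) * (\<Sum>q\<in>UNIV. Y $ k $ q * of_int (m $ q)))"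
    by (simp add: sum_distrib_left sum_distrib_right mult_ac)
  finally show ?thesis .
qed

lemma tendsto_det:
  fixes H :: "'a \<Rightarrow> complex^'n^'n"
  assumes "\<And>i k. ((\<lambda>s. H s $ i $ k) \<longlongrightarrow> L $ i $ k) F"
  shows "((\<lambda>s. det (H s)) \<longlongrightarrow> det L) F"
  unfolding det_def by (intro tendsto_intros assms)

text \<open>Along a generic one-parameter subgroup order the exponents by decreasing growth and choose a
  basis \<open>e\<close> of them greedily. In rescaled coordinates dual to this basis, only the
  exponents \<open>e i\<close> survive in the limit, on the diagonal.\<close>

lemma gram_nonsingular:
  fixes M :: "(int^'d) set"
  assumes fin: "finite M" and g: "\<And>m. m \<in> M \<Longrightarrow> g m \<noteq> 0" and span: "span (real_vec ` M) = UNIV"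
  shows "\<exists>v\<in>ctorus. det (gram g M v) \<noteq> 0"
proof -
  \<comment> \<open>A functional that is nonzero on these differences takes distinct values on
    \<open>M\<close>.\<close>
  let ?U = "(\<lambda>(m, n). real_vec m - real_vec n) ` {(m, n). m \<in> M \<and> n \<in> M \<and> m \<noteq> n}"
  have "finite ?U"
    by (intro finite_imageI finite_subset[OF _ finite_cartesian_product[OF fin fin]]) auto
  moreover have "0 \<notin> ?U" by auto
  ultimately obtain \<xi> where \<xi>: "\<And>u. u \<in> ?U \<Longrightarrow> u \<bullet> \<xi> \<noteq> 0"
    using avoid_hyperplanes[of ?U] by blast
  define l where "l m = \<xi> \<bullet> real_vec m" for m
  have l_inj: "m = n" if "l m = l n" "m \<in> M" "n \<in> M" for m n
  proof (rule ccontr)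
    assume "m \<noteq> n"
    with that have "real_vec m - real_vec n \<in> ?U"
      by (intro image_eqI[of _ _ "(m, n)"]) auto
    from \<xi>[OF this] that(1) show False
      by (simp add: l_def inner_diff_left inner_diff_right inner_commute)
  qed
  define S where "S m = real_vec ` {n \<in> M. l n > l m}" for m
  \<comment> \<open>The greedy choice: an exponent is kept if it is independent of those growing
    faster.\<close>
  define B where "B = {m \<in> M. real_vec m \<notin> span (S m)}"
  have spanB: "real_vec m \<in> span (real_vec ` B)" if "m \<in> M" for m
    using that
  proof (induction "card {n \<in> M. l n > l m}" arbitrary: m rule: less_induct)
    case less
    show ?case
    proof (cases "m \<in> B")
      case True
      then show ?thesis by (intro span_base imageI)
    next
      case False
      have "S m \<subseteq> span (real_vec ` B)"
      proof
        fix x assume "x \<in> S m"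
        then obtain n where n: "x = real_vec n" "n \<in> M" "l n > l m" by (auto simp: S_def)
        have "card {n' \<in> M. l n' > l n} < card {n' \<in> M. l n' > l m}"
          using n fin by (intro psubset_card_mono) auto
        from less.hyps[OF this n(2)] show "x \<in> span (real_vec ` B)"
          by (simp add: n(1))
      qed
      then have "span (S m) \<subseteq> span (real_vec ` B)"
        by (simp add: span_minimal)
      then show ?thesis using False less.prems by (auto simp: B_def)
    qed
  qed
  have finB: "finite B" using fin by (simp add: B_def)
  have "real_vec ` M \<subseteq> span (real_vec ` B)" using spanB by blast
  then have "span (real_vec ` M) \<subseteq> span (real_vec ` B)"
    by (simp add: span_minimal)
  then have "dim (UNIV :: (real^'d) set) \<le> card (real_vec ` B)"
    using span finB by (intro dim_le_card) auto
  then have "CARD('d) \<le> card B"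
    using card_image_le[OF finB, of real_vec] by (simp add: dim_UNIV)
  then obtain e :: "'d \<Rightarrow> int^'d" where e: "range e \<subseteq> B" "inj e"
    using card_le_inj[of "UNIV :: 'd set" B] finB by auto
  have eB: "e i \<in> B" for i using e(1) by blast
  \<comment> \<open>The component of \<open>e i\<close> orthogonal to the faster growing exponents
    serves as coordinate functional.\<close>
  have "\<exists>x. x \<bullet> real_vec (e i) \<noteq> 0 \<and> (\<forall>m\<in>M. l m > l (e i) \<longrightarrow> x \<bullet> real_vec m = 0)" for i
  proof -
    obtain y z where y: "y \<in> span (S (e i))" and z: "\<And>w. w \<in> span (S (e i)) \<Longrightarrow> orthogonal z w"
      and yz: "real_vec (e i) = y + z"
      using orthogonal_subspace_decomp_exists[of "S (e i)" "real_vec (e i)"] by metis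
    have "z \<noteq> 0" using eB[of i] y yz by (auto simp: B_def)
    then have "z \<bullet> real_vec (e i) \<noteq> 0"
      using z[OF y] by (simp add: yz inner_add_right orthogonal_def)
    moreover have "z \<bullet> real_vec m = 0" if "m \<in> M" "l m > l (e i)" for m
    proof -
      have "real_vec m \<in> span (S (e i))"
        using that by (intro span_base) (simp add: S_def)
      then show ?thesis using z by (simp add: orthogonal_def)
    qed
    ultimately show ?thesis by blast
  qed
  then obtain X where X1: "\<And>i. X i \<bullet> real_vec (e i) \<noteq> 0"
    and X0: "\<And>i m. m \<in> M \<Longrightarrow> l m > l (e i) \<Longrightarrow> X i \<bullet> real_vec m = 0" by metis
  have eM: "e i \<in> M" for i using eB[of i] by (simp add: B_def)
  \<comment> \<open>Each side of the congruence removes half of a growth rate, so entry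
    \<open>(i, k)\<close> is compared with the mean growth of \<open>e i\<close> and
    \<open>e k\<close>.\<close>
  define Y :: "real \<Rightarrow> complex^'d^'d"
    where "Y s = (\<chi> i k. of_real (exp (- s * l (e i) / 2) * X i $ k))" for s
  define H where "H s = Y s ** gram g M (exp_vec (s *\<^sub>R \<xi>)) ** transpose (Y s)" for s
  define L :: "complex^'d^'d"
    where "L = (\<chi> i k. if i = k then g (e i) * of_real ((X i \<bullet> real_vec (e i))\<^sup>2) else 0)"
  have Y: "(\<Sum>p\<in>UNIV. Y s $ i $ p * of_int (m $ p)) = of_real (exp (- s * l (e i) / 2) * (X i \<bullet> real_vec m))"
    for s i m
    by (simp add: Y_def inner_vec_def sum_distrib_left mult.assoc)
  have H: "H s $ i $ k = (\<Sum>m\<in>M. g m * of_real (exp (s * (l m - (l (e i) + l (e k)) / 2)) *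
      (X i \<bullet> real_vec m) * (X k \<bullet> real_vec m)))" for s i k
    unfolding H_def gram_congruence Y tmonom_exp_vec
  proof (intro sum.cong refl)
    fix m
    have "exp (s * (l m - (l (e i) + l (e k)) / 2)) = exp (s * l m) * exp (- s * l (e i) / 2) * exp (- s * l (e k) / 2)"
      by (simp add: exp_add[symmetric] field_simps)
    then show "g m * complex_of_real (exp (s *\<^sub>R \<xi> \<bullet> real_vec m)) *
          complex_of_real (exp (- s * l (e i) / 2) * (X i \<bullet> real_vec m)) *
          complex_of_real (exp (- s * l (e k) / 2) * (X k \<bullet> real_vec m)) =
         g m * complex_of_real (exp (s * (l m - (l (e i) + l (e k)) / 2)) * (X i \<bullet> real_vec m) * (X k \<bullet> real_vec m))"
      by (simp add: l_def)
  qed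
  have "((\<lambda>s. H s $ i $ k) \<longlongrightarrow> L $ i $ k) at_top" for i k
  proof -
    have term_lim: "((\<lambda>s. g m * of_real (exp (s * (l m - (l (e i) + l (e k)) / 2)) *
        (X i \<bullet> real_vec m) * (X k \<bullet> real_vec m))) \<longlongrightarrow> (if m = e i then L $ i $ k else 0)) at_top"
      if m: "m \<in> M" for m
    proof (cases "(X i \<bullet> real_vec m) * (X k \<bullet> real_vec m) = 0")
      case True
      then have "m = e i \<Longrightarrow> i \<noteq> k" using X1 by auto
      then show ?thesis using True by (auto simp: L_def)
    next
      case False
      then have le: "l m \<le> l (e i)" "l m \<le> l (e k)"
        using X0[OF m, of i] X0[OF m, of k] by force+
      show ?thesis
      proof (cases "m = e i \<and> i = k")
        case True
        then show ?thesis by (simp add: L_def power2_eq_square)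
      next
        case neq: False
        \<comment> \<open>Equality with the mean would force \<open>m = e i\<close> and
          \<open>m = e k\<close>, hence \<open>i = k\<close>. All other terms decay.\<close>
        have "l m < (l (e i) + l (e k)) / 2"
        proof (rule ccontr)
          assume "\<not> l m < (l (e i) + l (e k)) / 2"
          then have "l (e i) + l (e k) \<le> l m + l m" by simp
          then have "l m = l (e i)" "l m = l (e k)" using le by linarith+
          then have "m = e i" "m = e k" using m eM l_inj by blast+
          with neq e(2) show False by (auto dest: injD)
        qed
        then have "((\<lambda>s. exp (s * (l m - (l (e i) + l (e k)) / 2))) \<longlongrightarrow> 0) at_top"
          using filterlim_compose[OF exp_at_bot filterlim_tendsto_neg_mult_at_bot[OF tendsto_const _ filterlim_ident],
              of "l m - (l (e i) + l (e k)) / 2"]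
          by (simp add: mult.commute)
        then have "((\<lambda>s. g m * of_real (exp (s * (l m - (l (e i) + l (e k)) / 2)) *
          (X i \<bullet> real_vec m) * (X k \<bullet> real_vec m))) \<longlongrightarrow> g m * of_real (0 * (X i \<bullet> real_vec m) * (X k \<bullet> real_vec m))) at_top"
          by (intro tendsto_intros)
        then show ?thesis using neq by (auto simp: L_def)
      qed
    qed
    have "((\<lambda>s. H s $ i $ k) \<longlongrightarrow> (\<Sum>m\<in>M. if m = e i then L $ i $ k else 0)) at_top"
      unfolding H by (intro tendsto_sum term_lim)
    then show ?thesis using fin eM by simp
  qed
  then have "((\<lambda>s. det (H s)) \<longlongrightarrow> det L) at_top"
    by (rule tendsto_det)
  moreover have "det L \<noteq> 0"
    using g[OF eM] X1 by (subst det_diagonal) (auto simp: L_def)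
  ultimately have "\<forall>\<^sub>F s in at_top. det (H s) \<noteq> 0"
    by (rule tendsto_imp_eventually_ne)
  then obtain s where "det (H s) \<noteq> 0"
    using eventually_happens by fastforce
  then have "det (gram g M (exp_vec (s *\<^sub>R \<xi>))) \<noteq> 0"
    by (auto simp: H_def det_mul)
  then show ?thesis using exp_vec_in_ctorus by blast
qed

text \<open>If the exponents do not span, then a one-parameter subgroup acts trivially on all monomials.\<close>

lemma infinite_monomial_fibre:
  fixes M :: "(int^'d) set"
  assumes span: "span (real_vec ` M) \<noteq> UNIV" and v: "v \<in> ctorus"
  shows "infinite {w \<in> ctorus. \<forall>m\<in>M. tmonom m w = tmonom m v}"
proof -
  obtain u where u: "u \<noteq> 0" "\<And>x. x \<in> span (real_vec ` M) \<Longrightarrow> u \<bullet> x = 0"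
    using span_not_UNIV_orthogonal[OF span] by blast
  let ?w = "\<lambda>s. v * exp_vec (s *\<^sub>R u)"
  obtain k where k: "u $ k \<noteq> 0" using u(1) by (auto simp: vec_eq_iff)
  have "inj ?w"
  proof (rule injI)
    fix s t assume "?w s = ?w t"
    then have "v $ k * of_real (exp (s * u $ k)) = v $ k * of_real (exp (t * u $ k))"
      by (simp add: exp_vec_def vec_eq_iff)
    then show "s = t"
      using v k by (simp add: ctorus_def del: of_real_exp)
  qed
  then have "infinite (range ?w)"
    using infinite_UNIV_char_0 by (metis finite_imageD)
  moreover have "range ?w \<subseteq> {w \<in> ctorus. \<forall>m\<in>M. tmonom m w = tmonom m v}"
    using v u(2) by (auto simp: ctorus_mult tmonom_mult_arg tmonom_exp_vec span_base)
  ultimately show ?thesis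
    by (meson finite_subset)
qed

section \<open>The Lissajous map and its polytope\<close>

lemma scaled_mono:
  fixes P :: "'a::real_vector set"
  assumes "convex P" "0 \<in> P" "0 \<le> a" "a \<le> c"
  shows "(*\<^sub>R) a ` P \<subseteq> (*\<^sub>R) c ` P"
proof
  fix x assume "x \<in> (*\<^sub>R) a ` P"
  moreover have "0 \<in> (*\<^sub>R) (c - a) ` P" using assms(2) by force
  ultimately have "x + 0 \<in> (*\<^sub>R) (a + (c - a)) ` P"
    using assms by (intro convex_scaled_sum) auto
  then show "x \<in> (*\<^sub>R) c ` P" by simp
qed

lemma convex_scaled_setsum:
  fixes P :: "'a::real_vector set"
  assumes "convex P" "0 \<in> P" "finite J"
    and "\<And>j. j \<in> J \<Longrightarrow> 0 \<le> a j \<and> x j \<in> (*\<^sub>R) (a j) ` P"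
  shows "(\<Sum>j\<in>J. x j) \<in> (*\<^sub>R) (\<Sum>j\<in>J. a j) ` P"
  using assms(3,4)
proof (induction J)
  case empty
  then show ?case using assms(2) by force
next
  case (insert j J)
  then show ?case
    by (simp add: convex_scaled_sum[OF assms(1)] sum_nonneg)
qed

text \<open>Convexity makes the spaces \<open>Lk k\<close> a multiplicative filtration,
  \<open>0 \<in> P\<close> makes them increasing, and compactness keeps the supports finite.\<close>

locale lattice_body =
  fixes P :: "(real^'d) set"
  assumes convex: "convex P" and compact: "compact P" and zero: "0 \<in> P"
begin

abbreviation Lk :: "nat \<Rightarrow> (complex^'d \<Rightarrow> complex) set" where
  "Lk k \<equiv> laurent (lattice_points P k)"

lemma fin: "finite (lattice_points P k)"
  using compact by (intro finite_lattice_points compact_imp_bounded)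

lemma Lk_mono: "f \<in> Lk j \<Longrightarrow> j \<le> k \<Longrightarrow> f \<in> Lk k"
  using laurent_mono[OF _ lattice_points_mono[OF convex zero] fin] by blast

lemma Lk_monom: "m \<in> lattice_points P k \<Longrightarrow> (\<lambda>v. c * tmonom m v) \<in> Lk k"
  by (rule laurent_monom[OF fin])

lemma Lk_const: "(\<lambda>_. c) \<in> Lk k"
proof -
  have "(\<lambda>v. c * tmonom 0 v) \<in> Lk k"
    using zero by (intro Lk_monom) (auto simp: lattice_points_def intro: image_eqI[of _ _ 0])
  then show ?thesis by simp
qed

lemma Lk_mult: "f \<in> Lk j \<Longrightarrow> g \<in> Lk k \<Longrightarrow> (\<lambda>v. f v * g v) \<in> Lk (j + k)"
  using laurent_mult[OF _ _ fin fin fin] lattice_points_add[OF convex] by blast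

lemma Lk_scale: "f \<in> Lk k \<Longrightarrow> (\<lambda>v. c * f v) \<in> Lk k"
  using Lk_mult[OF Lk_const[of c 0], of f k] by simp

lemma Lk_diff: "f \<in> Lk k \<Longrightarrow> g \<in> Lk k \<Longrightarrow> (\<lambda>v. f v - g v) \<in> Lk k"
  using laurent_add[OF _ Lk_scale[of g k "-1"], of f] by simp

lemma Lk_sum: "(\<And>i. i \<in> I \<Longrightarrow> f i \<in> Lk k) \<Longrightarrow> (\<lambda>v. \<Sum>i\<in>I. f i v) \<in> Lk k"
  by (induction I rule: infinite_finite_induct) (auto intro: Lk_const laurent_add)

lemma Lk_prod: "finite I \<Longrightarrow> (\<And>i. i \<in> I \<Longrightarrow> f i \<in> Lk (k i)) \<Longrightarrow> (\<lambda>v. \<Prod>i\<in>I. f i v) \<in> Lk (\<Sum>i\<in>I. k i)"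
  by (induction I rule: finite_induct) (auto intro: Lk_const Lk_mult)

lemma Lk_power: "f \<in> Lk k \<Longrightarrow> (\<lambda>v. f v ^ n) \<in> Lk (n * k)"
  by (induction n) (auto intro: Lk_const Lk_mult)

lemma Lk_det:
  fixes J :: "complex^'d \<Rightarrow> complex^'e^'e"
  assumes "\<And>i k. (\<lambda>v. J v $ i $ k) \<in> Lk 1"
  shows "(\<lambda>v. det (J v)) \<in> Lk CARD('e)"
proof -
  have "(\<lambda>v. \<Prod>i\<in>UNIV. J v $ i $ p i) \<in> Lk CARD('e)" for p :: "'e \<Rightarrow> 'e"
    using Lk_prod[of UNIV "\<lambda>i v. J v $ i $ p i" "\<lambda>_. 1"] assms by simp
  then show ?thesis
    unfolding det_def by (intro Lk_sum Lk_scale)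
qed

end

section \<open>Supports of the Lissajous map and of its Jacobian determinant\<close>

definition exponents :: "int^'n^'d \<Rightarrow> (int^'d) set" where
  "exponents A = range (\<lambda>j. column j A) \<union> range (\<lambda>j. - column j A)"

text \<open>Columns may coincide up to sign, so contributions to the same exponent are added and may
  cancel. The minus sign arises because the term with exponent \<open>- column j A\<close> carries
  the vector \<open>column j A\<close>, the negative of its exponent.\<close>

definition exp_coeff :: "int^'n^'d \<Rightarrow> complex^'n \<Rightarrow> int^'d \<Rightarrow> complex" where
  "exp_coeff A b m = (\<Sum>j | column j A = m. lbeta b j / 2) - (\<Sum>j | - column j A = m. inverse (lbeta b j) / 2)"

lemma finite_exponents [simp]: "finite (exponents A)"
  by (simp add: exponents_def)

lemma sum_exponents:
  fixes A :: "int^'n^'d"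
  shows "(\<Sum>m\<in>exponents A. exp_coeff A b m * F m) =
    (\<Sum>j\<in>UNIV. (1/2) * (lbeta b j * F (column j A) - inverse (lbeta b j) * F (- column j A)))"
proof -
  have 1: "(\<Sum>m\<in>exponents A. \<Sum>j | column j A = m. lbeta b j / 2 * F (column j A)) = (\<Sum>j\<in>UNIV. lbeta b j / 2 * F (column j A))"
    using sum.group[of UNIV "exponents A" "\<lambda>j. column j A" "\<lambda>j. lbeta b j / 2 * F (column j A)"]
    by (simp add: exponents_def)
  have 2: "(\<Sum>m\<in>exponents A. \<Sum>j | - column j A = m. inverse (lbeta b j) / 2 * F (- column j A)) = (\<Sum>j\<in>UNIV. inverse (lbeta b j) / 2 * F (- column j A))"
    using sum.group[of UNIV "exponents A" "\<lambda>j. - column j A" "\<lambda>j. inverse (lbeta b j) / 2 * F (- column j A)"]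
    by (simp add: exponents_def)
  have "(\<Sum>m\<in>exponents A. exp_coeff A b m * F m) =
    (\<Sum>m\<in>exponents A. \<Sum>j | column j A = m. lbeta b j / 2 * F (column j A)) -
    (\<Sum>m\<in>exponents A. \<Sum>j | - column j A = m. inverse (lbeta b j) / 2 * F (- column j A))"
    by (simp add: exp_coeff_def left_diff_distrib sum_subtractf sum_distrib_right)
  also have "\<dots> = (\<Sum>j\<in>UNIV. (1/2) * (lbeta b j * F (column j A) - inverse (lbeta b j) * F (- column j A)))"
    unfolding 1 2 by (simp add: sum_subtractf[symmetric] algebra_simps)
  finally show ?thesis .
qed

definition lissajous_map :: "int^'n^'d \<Rightarrow> complex^'n \<Rightarrow> complex^'d \<Rightarrow> complex^'d" where
  "lissajous_map A b v = map_matrix of_int A *v lissajous_psi A b v"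

lemma lissajous_map_eq:
  "lissajous_map A b v $ i = (\<Sum>m\<in>exponents A. exp_coeff A b m * tmonom m v * of_int (m $ i))"
proof -
  have "(\<Sum>m\<in>exponents A. exp_coeff A b m * (tmonom m v * of_int (m $ i))) = lissajous_map A b v $ i"
    unfolding sum_exponents
    by (auto simp: lissajous_map_def matrix_vector_mult_def lissajous_psi_def map_matrix_def column_def
        algebra_simps intro!: sum.cong)
  then show ?thesis by (simp add: mult.assoc)
qed

text \<open>The entries are quadratic in the exponent, so its sign cancels, and the minus sign in
  \<open>exp_coeff\<close> becomes that of the diagonal matrix.\<close>

lemma toric_jacobi_eq: "toric_jacobi A b v = gram (exp_coeff A b) (exponents A) v"
proof -
  have "(\<Sum>m\<in>exponents A. exp_coeff A b m * (tmonom m v * of_int (m $ i) * of_int (m $ k))) = toric_jacobi A b v $ i $ k"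
    for i k
  proof -
    have "toric_jacobi A b v $ i $ k = (1/2) * (\<Sum>j\<in>UNIV. of_int (A $ i $ j) *
       (lbeta b j * tmonom (column j A) v - inverse (lbeta b j) * tmonom (- column j A) v) * of_int (A $ k $ j))"
      by (simp add: toric_jacobi_def matrix_matrix_mult_def diag_def transpose_def map_matrix_def
          if_distrib[of "\<lambda>x. _ * x"] cong: if_cong) (simp add: scaleR_conv_of_real)
    then show ?thesis
      unfolding sum_exponents by (auto simp: column_def sum_distrib_left algebra_simps intro!: sum.cong)
  qed
  then show ?thesis by (simp add: vec_eq_iff gram_def mult.assoc)
qed

lemma ramification_eq:
  "(v, w) \<in> ramification A b \<longleftrightarrow> v \<in> ctorus \<and> lissajous_map A b v = w \<and> det (toric_jacobi A b v) = 0"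
  by (auto simp: ramification_def incidence_def lissajous_map_def)

lemma lissajous_polytope_eq: "lissajous_polytope A = convex hull (real_vec ` exponents A)"
proof -
  have "column j (map_matrix real_of_int A) = real_vec (column j A)" for j
    by (simp add: vec_eq_iff column_def map_matrix_def)
  then show ?thesis
    by (simp add: lissajous_polytope_def exponents_def image_Un image_image)
qed

lemma lattice_body_lissajous:
  fixes A :: "int^'n^'d"
  shows "lattice_body (lissajous_polytope A)"
proof
  show "convex (lissajous_polytope A)" "compact (lissajous_polytope A)"
    by (auto simp: lissajous_polytope_eq finite_imp_compact_convex_hull)
  \<comment> \<open>Zero is the midpoint of a column and its negative; a column exists because types
    are nonempty.\<close>
  fix j :: 'n
  have "real_vec (column j A) \<in> lissajous_polytope A" "- real_vec (column j A) \<in> lissajous_polytope A"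
    unfolding lissajous_polytope_eq
    by (auto simp: exponents_def image_Un image_image intro!: hull_inc)
  then have "(1/2) *\<^sub>R real_vec (column j A) + (1/2) *\<^sub>R (- real_vec (column j A)) \<in> lissajous_polytope A"
    by (intro convexD) (auto simp: lissajous_polytope_eq)
  then show "0 \<in> lissajous_polytope A" by simp
qed

lemma exponents_lattice_points: "exponents A \<subseteq> lattice_points (lissajous_polytope A) 1"
  by (auto simp: lattice_points_def lissajous_polytope_eq intro: hull_inc)

lemma lissajous_map_laurent: "(\<lambda>v. lissajous_map A b v $ i) \<in> laurent (lattice_points (lissajous_polytope A) 1)"
proof -
  interpret lattice_body "lissajous_polytope A" by (rule lattice_body_lissajous)
  have "(\<lambda>v. \<Sum>m\<in>exponents A. (exp_coeff A b m * of_int (m $ i)) * tmonom m v) \<in> Lk 1"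
    using exponents_lattice_points by (intro Lk_sum Lk_monom) blast
  then show ?thesis
    unfolding lissajous_map_eq by (simp add: mult_ac)
qed

text \<open>Each term of the determinant is a product of \<open>CARD('d)\<close> entries supported
  in the polytope. This dilation is the source of the factor \<open>CARD('d)\<close> in the degree
  bound.\<close>

lemma det_toric_jacobi_laurent:
  fixes A :: "int^'n^'d"
  shows "(\<lambda>v. det (toric_jacobi A b v)) \<in> laurent (lattice_points (lissajous_polytope A) CARD('d))"
proof -
  interpret lattice_body "lissajous_polytope A" by (rule lattice_body_lissajous)
  have "(\<lambda>v. \<Sum>m\<in>exponents A. (exp_coeff A b m * of_int (m $ i) * of_int (m $ k)) * tmonom m v) \<in> Lk 1" for i k
    using exponents_lattice_points by (intro Lk_sum Lk_monom) blast
  then show ?thesis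
    by (intro Lk_det) (simp add: toric_jacobi_eq gram_def mult_ac)
qed

text \<open>By full rank the columns span, and the symmetric convex hull of a spanning set absorbs
  every vector, in particular the unit vectors.\<close>

lemma unit_cube_absorbed:
  fixes A :: "int^'n^'d"
  assumes "rank (map_matrix real_of_int A) = CARD('d)"
  obtains C where "C \<ge> 0" "box 0 1 \<subseteq> (*\<^sub>R) C ` lissajous_polytope A"
    "\<And>k. axis k 1 \<in> (*\<^sub>R) C ` lissajous_polytope A"
proof -
  let ?P = "lissajous_polytope A" and ?A = "map_matrix real_of_int A"
  interpret lattice_body ?P by (rule lattice_body_lissajous)
  have surj: "surj ((*v) ?A)"
    using assms by (simp add: full_rank_surjective)
  have cols: "real_vec (column j A) \<in> ?P" "- real_vec (column j A) \<in> ?P" for j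
    unfolding lissajous_polytope_eq
    by (auto simp: exponents_def image_Un image_image intro!: hull_inc)
  have absorb: "\<exists>a\<ge>0. x \<in> (*\<^sub>R) a ` ?P" for x
  proof -
    obtain y where y: "x = ?A *v y" using surj by blast
    have "x = (\<Sum>j\<in>UNIV. y $ j *\<^sub>R real_vec (column j A))"
      unfolding y by (auto simp: vec_eq_iff matrix_vector_mult_def column_def map_matrix_def mult.commute)
    moreover have "y $ j *\<^sub>R real_vec (column j A) \<in> (*\<^sub>R) \<bar>y $ j\<bar> ` ?P" for j
      using cols[of j] by (cases "y $ j \<ge> 0")
        (auto intro: image_eqI[of _ _ "real_vec (column j A)"] image_eqI[of _ _ "- real_vec (column j A)"])
    ultimately have "x \<in> (*\<^sub>R) (\<Sum>j\<in>UNIV. \<bar>y $ j\<bar>) ` ?P"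
      using convex_scaled_setsum[OF convex zero, of UNIV "\<lambda>j. \<bar>y $ j\<bar>" "\<lambda>j. y $ j *\<^sub>R real_vec (column j A)"]
      by simp
    then show ?thesis
      by (intro exI[of _ "\<Sum>j\<in>UNIV. \<bar>y $ j\<bar>"]) (simp add: sum_nonneg)
  qed
  have "\<forall>k. \<exists>a\<ge>0. axis k 1 \<in> (*\<^sub>R) a ` ?P"
    by (intro allI absorb)
  from choice[OF this] obtain a where a: "\<And>k. a k \<ge> 0" "\<And>k. axis k 1 \<in> (*\<^sub>R) (a k) ` ?P"
    by blast
  show thesis
  proof (rule that[of "\<Sum>k\<in>UNIV. a k"])
    show "(\<Sum>k\<in>UNIV. a k) \<ge> 0" using a by (simp add: sum_nonneg)
    show "axis k 1 \<in> (*\<^sub>R) (\<Sum>k\<in>UNIV. a k) ` ?P" for k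
      using scaled_mono[OF convex zero a(1)[of k], of "\<Sum>k\<in>UNIV. a k"] member_le_sum[of k UNIV a] a by auto
    show "box 0 1 \<subseteq> (*\<^sub>R) (\<Sum>k\<in>UNIV. a k) ` ?P"
    proof
      fix x :: "real^'d" assume "x \<in> box 0 1"
      then have x: "0 \<le> x $ k" "x $ k \<le> 1" for k
        by (auto simp: mem_box_cart less_imp_le)
      have "x $ k *\<^sub>R axis k 1 \<in> (*\<^sub>R) (x $ k * a k) ` ?P" for k
        using a(2)[of k] by auto
      then have "(\<Sum>k\<in>UNIV. x $ k *\<^sub>R axis k 1) \<in> (*\<^sub>R) (\<Sum>k\<in>UNIV. x $ k * a k) ` ?P"
        using x a by (intro convex_scaled_setsum[OF convex zero]) auto
      moreover have "(\<Sum>k\<in>UNIV. x $ k *\<^sub>R axis k 1) = x"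
        by (simp add: vec_eq_iff axis_def if_distrib[of "\<lambda>y. _ * y"] cong: if_cong)
      moreover have "(\<Sum>k\<in>UNIV. x $ k * a k) \<le> (\<Sum>k\<in>UNIV. a k)"
        using x a by (intro sum_mono mult_left_le_one_le) auto
      moreover have "0 \<le> (\<Sum>k\<in>UNIV. x $ k * a k)"
        using x a by (intro sum_nonneg) auto
      ultimately show "x \<in> (*\<^sub>R) (\<Sum>k\<in>UNIV. a k) ` ?P"
        using scaled_mono[OF convex zero] by force
    qed
  qed
qed

text \<open>A coordinate is the monomial of a unit vector, which lies in some dilate of the
  polytope. This bounds the support of linear forms.\<close>

lemma coordinate_laurent:
  fixes A :: "int^'n^'d"
  assumes "rank (map_matrix real_of_int A) = CARD('d)"
  obtains c where "\<And>k. (\<lambda>v. v $ k) \<in> laurent (lattice_points (lissajous_polytope A) c)"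
proof -
  let ?P = "lissajous_polytope A"
  interpret lattice_body ?P by (rule lattice_body_lissajous)
  obtain C where C: "C \<ge> 0" "\<And>k. axis k 1 \<in> (*\<^sub>R) C ` ?P"
    using unit_cube_absorbed[OF assms] by metis
  show thesis
  proof (rule that[of "nat \<lceil>C\<rceil>"])
    fix k :: 'd
    have "real_vec (axis k 1) = axis k 1"
      by (simp add: vec_eq_iff axis_def)
    then have "axis k 1 \<in> lattice_points ?P (nat \<lceil>C\<rceil>)"
      using C(2)[of k] scaled_mono[OF convex zero C(1), of "real (nat \<lceil>C\<rceil>)"]
      by (auto simp: lattice_points_def real_nat_ceiling_ge)
    from Lk_monom[OF this, of 1] have "(\<lambda>v. tmonom (axis k 1) v) \<in> Lk (nat \<lceil>C\<rceil>)" by simp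
    moreover have "tmonom (axis k 1) v = v $ k" for v :: "complex^'d"
      unfolding tmonom_def axis_def by (simp add: if_distrib[of "\<lambda>y. _ powi y"] cong: if_cong)
    ultimately show "(\<lambda>v. v $ k) \<in> Lk (nat \<lceil>C\<rceil>)" by simp
  qed
qed

text \<open>If the determinant vanished on the torus, whole fibres of the map would lie in the
  ramification locus. By \<open>gram_nonsingular\<close> the exponents that occur would not span, so
  these fibres would be infinite.\<close>

lemma det_toric_jacobi_nonzero:
  fixes A :: "int^'n^'d"
  assumes deg: "ramification_degree A b \<delta>"
  shows "\<exists>v\<in>ctorus. det (toric_jacobi A b v) \<noteq> 0"
proof (rule ccontr)
  assume "\<not> ?thesis"
  then have zero: "\<And>v. v \<in> ctorus \<Longrightarrow> det (toric_jacobi A b v) = 0" by blast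
  \<comment> \<open>Exponents whose coefficients cancel are discarded, as
    \<open>gram_nonsingular\<close> asks for nonzero weights.\<close>
  let ?M = "{m \<in> exponents A. exp_coeff A b m \<noteq> 0}"
  have gram: "toric_jacobi A b v = gram (exp_coeff A b) ?M v" for v
  proof -
    have "(\<Sum>m\<in>exponents A. exp_coeff A b m * tmonom m v * of_int (m $ i) * of_int (m $ k)) =
      (\<Sum>m\<in>?M. exp_coeff A b m * tmonom m v * of_int (m $ i) * of_int (m $ k))" for i k
      by (intro sum.mono_neutral_right) auto
    then show ?thesis
      unfolding toric_jacobi_eq gram_def by simp
  qed
  have map: "lissajous_map A b v $ i = (\<Sum>m\<in>?M. exp_coeff A b m * tmonom m v * of_int (m $ i))" for v i
    unfolding lissajous_map_eq by (intro sum.mono_neutral_right) auto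
  have span: "span (real_vec ` ?M) \<noteq> UNIV"
  proof
    assume "span (real_vec ` ?M) = UNIV"
    then have "\<exists>v\<in>ctorus. det (gram (exp_coeff A b) ?M v) \<noteq> 0"
      by (intro gram_nonsingular) simp_all
    then obtain v where "v \<in> ctorus" "det (gram (exp_coeff A b) ?M v) \<noteq> 0"
      by blast
    with zero[of v] show False
      by (simp add: gram)
  qed
  from deg obtain U where \<delta>: "\<delta> > 0" and U: "openin (subtopology zariski (lissajous_disc A b)) U"
     "subtopology zariski (lissajous_disc A b) closure_of U = lissajous_disc A b"
     "\<And>w. w \<in> U \<Longrightarrow> card {v. (v, w) \<in> ramification A b} = \<delta>"
    unfolding ramification_degree_def by blast
  have "(1, lissajous_map A b 1) \<in> ramification A b"
    by (simp add: ramification_eq zero)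
  then have "lissajous_map A b 1 \<in> snd ` ramification A b"
    by (rule image_eqI[rotated]) simp
  moreover have "snd ` ramification A b \<subseteq> lissajous_disc A b"
    unfolding lissajous_disc_def by (intro closure_of_subset) simp
  ultimately have "lissajous_disc A b \<noteq> {}" by blast
  then have "U \<noteq> {}"
    using U(2) closure_of_empty by metis
  then obtain w where "w \<in> U" by blast
  \<comment> \<open>Positive cardinality says both that the fibre is nonempty and that it is
    finite.\<close>
  with U(3) \<delta> have fib: "card {v. (v, w) \<in> ramification A b} > 0" by simp
  then have "{v. (v, w) \<in> ramification A b} \<noteq> {}"
    unfolding card_gt_0_iff by (rule conjunct1)
  then obtain v where v: "v \<in> ctorus" "lissajous_map A b v = w"
    by (auto simp: ramification_eq)
  have "{u \<in> ctorus. \<forall>m\<in>?M. tmonom m u = tmonom m v} \<subseteq> {v. (v, w) \<in> ramification A b}"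
  proof
    fix u assume u: "u \<in> {u \<in> ctorus. \<forall>m\<in>?M. tmonom m u = tmonom m v}"
    have "lissajous_map A b u $ i = lissajous_map A b v $ i" for i
      unfolding map using u by (intro sum.cong) auto
    then have "lissajous_map A b u = w"
      using v(2) by (simp add: vec_eq_iff)
    with u zero show "u \<in> {v. (v, w) \<in> ramification A b}"
      by (simp add: ramification_eq)
  qed
  then have "infinite {v. (v, w) \<in> ramification A b}"
    by (rule infinite_super) (rule infinite_monomial_fibre[OF span v(1)])
  with fib show False by simp
qed

section \<open>Dimension count on the ramification locus\<close>

lemma sum_powers_ge: "real J ^ Suc n / real (Suc n) \<le> (\<Sum>j<J. real (Suc j) ^ n)"
proof (induction J)
  case (Suc J)
  \<comment> \<open>The increment of the power is a sum of \<open>Suc n\<close> products, each at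
    most \<open>real (Suc J) ^ n\<close>.\<close>
  have "real (Suc J) ^ Suc n - real J ^ Suc n = (\<Sum>p<Suc n. real (Suc J) ^ p * real J ^ (n - p))"
    by (subst diff_power_eq_sum) simp
  also have "\<dots> \<le> of_nat (card {..<Suc n}) * real (Suc J) ^ n"
  proof (rule sum_bounded_above)
    fix p assume p: "p \<in> {..<Suc n}"
    have "real (Suc J) ^ p * real J ^ (n - p) \<le> real (Suc J) ^ p * real (Suc J) ^ (n - p)"
      by (intro mult_left_mono power_mono) auto
    also have "\<dots> = real (Suc J) ^ n"
      using p by (simp flip: power_add)
    finally show "real (Suc J) ^ p * real J ^ (n - p) \<le> real (Suc J) ^ n" .
  qed
  finally have "real (Suc J) ^ Suc n / real (Suc n) \<le> real J ^ Suc n / real (Suc n) + real (Suc J) ^ n"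
    by (simp add: field_simps del: power_Suc of_nat_Suc)
  with Suc show ?case by simp
qed simp

text \<open>Prescribing zero outside \<open>A\<close> makes the set finite for finite
  \<open>A\<close>.\<close>

definition multi_indices :: "'i set \<Rightarrow> nat \<Rightarrow> ('i \<Rightarrow> nat) set" where
  "multi_indices A K = {\<mu>. (\<forall>i. i \<notin> A \<longrightarrow> \<mu> i = 0) \<and> sum \<mu> A \<le> K}"

text \<open>Splitting off the entry at \<open>a\<close> turns the count into a sum of the counts for
  \<open>A\<close> over all bounds up to \<open>K\<close>, to which the power sum estimate
  applies.\<close>

lemma card_multi_indices:
  assumes "finite A"
  shows "finite (multi_indices A K) \<and> real K ^ card A / fact (card A) \<le> real (card (multi_indices A K))"
  using assms
proof (induction A arbitrary: K)
  case empty
  have "multi_indices {} K = {\<lambda>_::'a. 0}" by (auto simp: multi_indices_def)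
  then show ?case by simp
next
  case (insert a A)
  let ?n = "card A"
  let ?T = "SIGMA l:{..K}. multi_indices A (K - l)"
  let ?g = "\<lambda>(l, \<mu>). \<mu>(a := l)"
  have sum_upd: "sum (\<mu>(a := l)) A = sum \<mu> A" for \<mu> :: "'a \<Rightarrow> nat" and l
    using insert by (intro sum.cong) auto
  have inj: "inj_on ?g ?T"
  proof (rule inj_onI, clarsimp)
    fix l \<mu> l' \<mu>'
    assume *: "\<mu> \<in> multi_indices A (K - l)" "\<mu>' \<in> multi_indices A (K - l')" "\<mu>(a := l) = \<mu>'(a := l')"
    have "\<mu> i = \<mu>' i" for i
    proof (cases "i = a")
      case True
      then show ?thesis using *(1,2) insert.hyps(2) by (simp add: multi_indices_def)
    next
      case False
      then show ?thesis using fun_cong[OF *(3), of i] by simp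
    qed
    with fun_cong[OF *(3), of a] show "l = l' \<and> \<mu> = \<mu>'" by auto
  qed
  have img: "?g ` ?T = multi_indices (insert a A) K"
  proof (intro equalityI subsetI)
    fix \<mu> assume "\<mu> \<in> ?g ` ?T"
    then show "\<mu> \<in> multi_indices (insert a A) K"
      using insert sum_upd by (auto simp: multi_indices_def)
  next
    fix \<mu> assume \<mu>: "\<mu> \<in> multi_indices (insert a A) K"
    then have "(\<mu> a, \<mu>(a := 0)) \<in> ?T"
      using insert sum_upd by (auto simp: multi_indices_def)
    then show "\<mu> \<in> ?g ` ?T"
      by (rule image_eqI[rotated]) simp
  qed
  have "finite ?T" using insert.IH by auto
  then have fin: "finite (multi_indices (insert a A) K)"
    unfolding img[symmetric] by (rule finite_imageI)
  have "card (multi_indices (insert a A) K) = (\<Sum>l\<le>K. card (multi_indices A (K - l)))"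
    unfolding img[symmetric] card_image[OF inj] using insert.IH by (subst card_SigmaI) auto
  also have "\<dots> = (\<Sum>j\<le>K. card (multi_indices A j))"
    by (rule sum.reindex_bij_witness[of _ "\<lambda>j. K - j" "\<lambda>j. K - j"]) auto
  finally have card: "real (card (multi_indices (insert a A) K)) = (\<Sum>j\<le>K. real (card (multi_indices A j)))"
    by simp
  have "real K ^ card (insert a A) / fact (card (insert a A)) = real K ^ Suc ?n / real (Suc ?n) / fact ?n"
    using insert by simp
  also have "\<dots> \<le> (\<Sum>j<K. real (Suc j) ^ ?n) / fact ?n"
    by (intro divide_right_mono sum_powers_ge) simp
  also have "\<dots> = (\<Sum>j<K. real (Suc j) ^ ?n / fact ?n)"
    by (rule sum_divide_distrib)
  also have "\<dots> \<le> (\<Sum>j<K. real (card (multi_indices A (Suc j))))"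
    using insert.IH by (intro sum_mono) blast
  also have "\<dots> \<le> (\<Sum>j\<le>K. real (card (multi_indices A j)))"
    by (subst sum.atMost_shift) simp
  finally show ?case
    using card fin by simp
qed

section \<open>Affine coordinates adapted to a line\<close>

definition chart_fst :: "complex^('d + 'd) \<Rightarrow> 'd \<Rightarrow> complex^'d \<Rightarrow> complex" where
  "chart_fst z k w = (w - line_point z) $ k / line_dir z $ k"

text \<open>If the direction has nonzero component \<open>k\<close>, this moves the base point to
  the origin and projects along the direction onto the hyperplane where coordinate \<open>k\<close>
  is zero. The line is then its zero set.\<close>

definition chart_snd :: "complex^('d + 'd) \<Rightarrow> 'd \<Rightarrow> complex^'d \<Rightarrow> complex^'d" where
  "chart_snd z k w = w - line_point z - chart_fst z k w *s line_dir z"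

definition chart_monom :: "complex^('d + 'd) \<Rightarrow> 'd \<Rightarrow> nat \<times> ('d \<Rightarrow> nat) \<Rightarrow> complex^'d \<Rightarrow> complex" where
  "chart_monom z k e w = chart_fst z k w ^ fst e * (\<Prod>i\<in>UNIV. chart_snd z k w $ i ^ snd e i)"

lemma chart_monom_polyfun: "chart_monom z k e \<in> polyfuns"
proof -
  have 1: "chart_fst z k \<in> polyfuns"
    unfolding chart_fst_def divide_inverse vector_minus_component by (intro polyfuns_intros)
  then have "(\<lambda>w. chart_snd z k w $ i) \<in> polyfuns" for i
    unfolding chart_snd_def vector_minus_component vector_smult_component by (intro polyfuns_intros)
  with 1 show ?thesis
    unfolding chart_monom_def by (intro polyfuns_intros)
qed

lemma poly_many_roots_zero:
  fixes g :: "nat \<Rightarrow> complex"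
  assumes "D \<le> card R" and "\<And>t. t \<in> R \<Longrightarrow> (\<Sum>j<D. g j * t ^ j) = 0" and "j < D"
  shows "g j = 0"
proof -
  define G where "G = (\<Sum>j<D. monom (g j) j)"
  have cf: "coeff G i = (if i < D then g i else 0)" for i
    by (simp add: G_def coeff_sum)
  have "G = 0"
  proof (rule ccontr)
    assume G: "G \<noteq> 0"
    have "R \<subseteq> {t. poly G t = 0}"
      using assms(2) by (auto simp: G_def poly_sum poly_monom)
    then have "card R \<le> card {t. poly G t = 0}"
      using poly_roots_finite[OF G] by (rule card_mono[rotated])
    also have "\<dots> \<le> degree G"
      using G by (rule card_poly_roots_bound)
    also have "\<dots> < D"
      using leading_coeff_neq_0[OF G] unfolding cf by (auto split: if_splits)
    finally show False using assms(1) by simp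
  qed
  then show ?thesis using cf[of j] assms(3) by simp
qed

text \<open>On the line through \<open>line_point z0 + y\<close> parallel to \<open>line_dir z0\<close>, where \<open>y $ k = 0\<close>, the
  function \<open>chart_fst\<close> is the line parameter and \<open>chart_snd\<close> is \<open>y\<close>.\<close>

lemma chart_monom_independent:
  fixes f :: "complex^'d \<Rightarrow> complex"
  assumes f: "f \<in> polyfuns" and \<Delta>: "\<Delta> \<in> polyfuns" "\<Delta> z0 \<noteq> 0"
    and D: "\<And>z. \<Delta> z \<noteq> 0 \<Longrightarrow> D \<le> card {t. poly (line_restrict f z) t = 0}"
    and k: "line_dir z0 $ k \<noteq> 0" and S: "finite S" "\<And>\<mu>. \<mu> \<in> S \<Longrightarrow> \<mu> k = 0"
    and van: "\<And>w. f w = 0 \<Longrightarrow> (\<Sum>e\<in>{..<D} \<times> S. c e * chart_monom z0 k e w) = 0"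
    and j: "j < D" and \<mu>: "\<mu> \<in> S"
  shows "c (j, \<mu>) = 0"
proof -
  define y :: "complex^'d \<Rightarrow> complex^'d" where "y x = (\<chi> i. if i = k then 0 else x $ i)" for x
  define z where "z x = line_param (line_point z0 + y x) (line_dir z0)" for x
  define g where "g j x = (\<Sum>\<mu>\<in>S. c (j, \<mu>) * (\<Prod>i\<in>UNIV. x $ i ^ \<mu> i))" for j and x :: "complex^'d"
  define q where "q x = \<Delta> (z x)" for x
  have q: "q \<in> polyfuns"
    unfolding q_def
  proof (rule polyfuns_compose[OF \<Delta>(1)])
    fix s show "(\<lambda>x. z x $ s) \<in> polyfuns"
    proof (cases s)
      case (Inl i)
      then show ?thesis
        unfolding z_def y_def line_param_def
        by (cases "i = k") (auto intro!: polyfuns_intros)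
    next
      case (Inr i)
      then show ?thesis
        by (simp add: z_def line_param_def polyfuns.const)
    qed
  qed
  have "y 0 = 0" by (simp add: y_def vec_eq_iff)
  then have q0: "q 0 \<noteq> 0"
    using \<Delta>(2) by (simp add: q_def z_def line_param_collapse)
  have g0: "g j x = 0" if "q x \<noteq> 0" for x
  proof (rule poly_many_roots_zero[of D "{t. poly (line_restrict f (z x)) t = 0}" "\<lambda>j. g j x", OF _ _ j])
    show "D \<le> card {t. poly (line_restrict f (z x)) t = 0}"
      using that by (intro D) (simp add: q_def)
    fix t assume "t \<in> {t. poly (line_restrict f (z x)) t = 0}"
    then have "f (line_point z0 + y x + t *s line_dir z0) = 0" (is "f ?w = 0")
      by (simp add: poly_line_restrict[OF f] z_def)
    note 0 = van[OF this]
    have fst: "chart_fst z0 k ?w = t"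
      using k by (simp add: chart_fst_def y_def)
    then have snd: "chart_snd z0 k ?w = y x"
      by (simp add: chart_snd_def)
    \<comment> \<open>Since \<open>\<mu> k = 0\<close>, coordinate \<open>k\<close> only enters as a
      zeroth power, which is 1 also at 0.\<close>
    have mon: "(\<Prod>i\<in>UNIV. y x $ i ^ \<mu> i) = (\<Prod>i\<in>UNIV. x $ i ^ \<mu> i)" if "\<mu> \<in> S" for \<mu>
      using S(2)[OF that] by (intro prod.cong) (auto simp: y_def)
    have "(\<Sum>j<D. g j x * t ^ j) = (\<Sum>j<D. \<Sum>\<mu>\<in>S. c (j, \<mu>) * chart_monom z0 k (j, \<mu>) ?w)"
      unfolding g_def sum_distrib_right chart_monom_def fst snd
      by (intro sum.cong refl) (simp add: mon)
    also have "\<dots> = 0"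
      using 0 by (simp add: sum.cartesian_product case_prod_unfold)
    finally show "(\<Sum>j<D. g j x * t ^ j) = 0" .
  qed
  have gp: "g j \<in> polyfuns"
    unfolding g_def by (intro polyfuns_intros)
  \<comment> \<open>The polynomial \<open>g j\<close> vanishes wherever \<open>q\<close> does not,
    and \<open>q\<close> is nonzero at 0.\<close>
  have "g j x = 0" for x
  proof (rule ccontr)
    assume "g j x \<noteq> 0"
    from polyfuns_mult_nonzero[OF gp q this q0] g0 show False by blast
  qed
  \<comment> \<open>Distinct multi-indices give distinct characters of the torus, so the
    coefficients of \<open>g j\<close> vanish.\<close>
  define e where "e \<mu> = (\<chi> i. int (\<mu> i))" for \<mu> :: "'d \<Rightarrow> nat"
  have inj: "inj_on e S"
    by (auto intro!: inj_onI simp: e_def vec_eq_iff)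
  have tm: "tmonom (e \<mu>) x = (\<Prod>i\<in>UNIV. x $ i ^ \<mu> i)" for \<mu> x
    by (simp add: tmonom_def e_def)
  have "(\<lambda>m. c (j, the_inv_into S e m)) (e \<mu>) = 0"
  proof (rule tmonom_independent[of "e ` S"])
    show "(\<Sum>m\<in>e ` S. c (j, the_inv_into S e m) * tmonom m x) = 0" for x
      using \<open>g j x = 0\<close> unfolding sum.reindex[OF inj] g_def
      by (simp add: the_inv_into_f_f[OF inj] tm)
  qed (use S(1) \<mu> in auto)
  then show ?thesis
    by (simp add: the_inv_into_f_f[OF inj \<mu>])
qed

section \<open>Linear forms separating the points of finitely many fibres\<close>

definition linear_form :: "real^'d \<Rightarrow> complex^'d \<Rightarrow> complex" where
  "linear_form x v = (\<Sum>k\<in>UNIV. of_real (x $ k) * v $ k)"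

lemma separating_linear_form:
  fixes F :: "'x \<Rightarrow> (complex^'d) set"
  assumes "finite S" "\<And>w. w \<in> S \<Longrightarrow> finite (F w)"
  shows "\<exists>x. \<forall>w\<in>S. inj_on (linear_form x) (F w)"
proof -
  define r i where "r u = (\<chi> k. Re (u $ k))" and "i u = (\<chi> k. Im (u $ k))" for u :: "complex^'d"
  \<comment> \<open>A form with real coefficients vanishes at \<open>u\<close> only if they are
    orthogonal to both the real and the imaginary part of \<open>u\<close>, so it suffices to
    control one nonzero part.\<close>
  define h where "h u = (if r u = 0 then i u else r u)" for u
  have h0: "u = 0" if "h u = 0" for u
    using that by (auto simp: h_def r_def i_def vec_eq_iff complex_eq_iff split: if_splits)
  let ?U = "\<Union>w\<in>S. (\<lambda>(u, v). h (u - v)) ` ((F w \<times> F w) - Id)"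
  have "finite ?U"
    using assms by (intro finite_UN_I finite_imageI finite_Diff finite_cartesian_product) auto
  moreover have "0 \<notin> ?U"
    by (auto dest!: h0)
  ultimately have "\<exists>x. \<forall>u\<in>?U. u \<bullet> x \<noteq> 0"
    by (rule avoid_hyperplanes)
  then obtain x where x: "\<forall>u\<in>?U. u \<bullet> x \<noteq> 0" ..
  have nz: "linear_form x u \<noteq> 0" if "h u \<bullet> x \<noteq> 0" for u
  proof
    assume "linear_form x u = 0"
    then have "Re (linear_form x u) = 0" "Im (linear_form x u) = 0" by simp_all
    then have "r u \<bullet> x = 0" "i u \<bullet> x = 0"
      by (simp_all add: linear_form_def r_def i_def inner_vec_def mult.commute)
    with that show False by (simp add: h_def split: if_splits)
  qed
  have "inj_on (linear_form x) (F w)" if "w \<in> S" for w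
  proof (rule inj_onI, rule ccontr)
    fix u v assume uv: "u \<in> F w" "v \<in> F w" "linear_form x u = linear_form x v" "u \<noteq> v"
    then have "h (u - v) \<in> ?U"
      using that by (intro UN_I[of w] image_eqI[of _ _ "(u, v)"]) auto
    from nz[OF bspec[OF x this]] uv(3) show False
      by (simp add: linear_form_def right_diff_distrib sum_subtractf)
  qed
  then show ?thesis by blast
qed

section \<open>Passage to the limit\<close>

lemma asymptotic_count:
  fixes N S :: "nat \<Rightarrow> nat" and C V :: real
  assumes d: "d > 0"
    and step: "\<And>K. d \<le> c + K \<Longrightarrow> N (c + K - d) + q * S K \<le> N (c + K)"
    and S: "\<And>K. real K ^ (d - 1) / fact (d - 1) \<le> real (S K)"
    and N: "\<And>k. real (N k) \<le> (real k + C) ^ d * V"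
  shows "real q \<le> real d * fact d * V"
proof -
  obtain n where n: "d = Suc n" using d by (cases d) auto
  \<comment> \<open>Starting at \<open>K = d\<close> makes the subtraction of \<open>d\<close>
    exact, and consecutive inequalities telescope.\<close>
  have tele: "(\<Sum>j<J. q * S (Suc j * d)) \<le> N (c + J * d)" for J
  proof (induction J)
    case (Suc J)
    have "N (c + J * d) + q * S (Suc J * d) \<le> N (c + Suc J * d)"
      using step[of "Suc J * d"] by (simp add: add.commute add.left_commute)
    with Suc show ?case by simp
  qed simp
  have S': "real K ^ n / fact n \<le> real (S K)" for K
    using S[of K] n by simp
  \<comment> \<open>After division by \<open>real J ^ d\<close>, letting \<open>J\<close> tend to
    infinity compares the leading coefficients \<open>q * d ^ (d - 1) / fact d\<close> and
    \<open>d ^ d * V\<close>.\<close>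
  have bound: "real q * real d ^ n / fact d \<le> ((real c + C) / real J + real d) ^ d * V" if J: "J > 0" for J
  proof -
    have "real q * real d ^ n / fact n * (real J ^ Suc n / real (Suc n))
        \<le> real q * real d ^ n / fact n * (\<Sum>j<J. real (Suc j) ^ n)"
      by (intro mult_left_mono sum_powers_ge) simp
    also have "\<dots> = (\<Sum>j<J. real q * (real (Suc j * d) ^ n / fact n))"
      unfolding of_nat_mult power_mult_distrib
      by (simp add: sum_distrib_left mult_ac sum_divide_distrib del: of_nat_Suc)
    also have "\<dots> \<le> (\<Sum>j<J. real q * real (S (Suc j * d)))"
      by (intro sum_mono mult_left_mono S') simp
    also have "\<dots> = real (\<Sum>j<J. q * S (Suc j * d))" by simp
    also have "\<dots> \<le> real (N (c + J * d))"
      using tele by (simp only: of_nat_le_iff)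
    also have "\<dots> \<le> (real (c + J * d) + C) ^ d * V" by (rule N)
    finally have "real q * real d ^ n / fact n * (real J ^ Suc n / real (Suc n)) / real J ^ d
        \<le> (real (c + J * d) + C) ^ d * V / real J ^ d"
      by (intro divide_right_mono) auto
    moreover have "real q * real d ^ n / fact n * (real J ^ Suc n / real (Suc n)) / real J ^ d = real q * real d ^ n / fact d"
      using J by (simp add: n)
    moreover have "(real (c + J * d) + C) ^ d * V / real J ^ d = ((real c + C) / real J + real d) ^ d * V"
    proof -
      have "(real c + C) / real J + real d = (real (c + J * d) + C) / real J"
        using J by (simp add: field_simps)
      then show ?thesis by (simp add: power_divide)
    qed
    ultimately show ?thesis by simp
  qed
  have "((\<lambda>J. ((real c + C) / real J + real d) ^ d * V) \<longlongrightarrow> (0 + real d) ^ d * V) sequentially"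
    by (intro tendsto_intros lim_const_over_n)
  then have "real q * real d ^ n / fact d \<le> (0 + real d) ^ d * V"
    by (rule LIMSEQ_le_const) (use bound in \<open>auto intro!: exI[of _ 1]\<close>)
  then have "real q * real d ^ n \<le> real d ^ d * V * fact d"
    by (simp add: pos_divide_le_eq)
  also have "\<dots> = real d ^ n * (real d * fact d * V)"
    unfolding n by (simp only: power_Suc mult_ac)
  finally have "real q * real d ^ n \<le> real d ^ n * (real d * fact d * V)" .
  then show ?thesis
    using d by (simp add: mult.commute[of "real q"])
qed

section \<open>Comparison of dimensions\<close>

lemma polyfun_zero_on_closure:
  assumes "g \<in> polyfuns" and "subtopology zariski V closure_of U = V" and "U \<subseteq> V"
    and "\<And>w. w \<in> U \<Longrightarrow> g w = 0" and "w \<in> V"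
  shows "g w = 0"
proof -
  have "zariski closure_of U \<subseteq> zero_locus {g}"
    using assms(1,4) by (intro closure_of_minimal) (auto simp: zero_locus_def closedin_zariski)
  moreover have "V \<subseteq> zariski closure_of U"
    using assms(2,3) by (metis closure_of_subtopology inf_le2 inf.absorb2)
  ultimately show ?thesis
    using assms(5) by (auto simp: zero_locus_def)
qed

text \<open>Two families with support in the dilate by \<open>n\<close> are jointly independent:
  monomials times the Jacobian determinant, and the pulled back products. The first vanish on the
  ramification locus, where the second stay independent.\<close>

lemma counting_inequality:
  fixes A :: "int^'n^'d" and f :: "complex^'d \<Rightarrow> complex"
  assumes disc: "lissajous_disc A b = {w. f w = 0}" and f: "f \<in> polyfuns"
    and deg: "ramification_degree A b \<delta>"
    and \<Delta>: "\<Delta> \<in> polyfuns" "\<Delta> z0 \<noteq> 0"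
    and D: "\<And>z. \<Delta> z \<noteq> 0 \<Longrightarrow> D \<le> card {t. poly (line_restrict f z) t = 0}"
    and k: "line_dir z0 $ k \<noteq> 0"
    and coord: "\<And>i. (\<lambda>v. v $ i) \<in> laurent (lattice_points (lissajous_polytope A) c)"
    and n: "n = \<delta> * c + D + K" "CARD('d) \<le> n"
  shows "card (lattice_points (lissajous_polytope A) (n - CARD('d))) +
      \<delta> * (D * card (multi_indices (UNIV - {k}) K)) \<le> card (lattice_points (lissajous_polytope A) n)"
proof -
  interpret lattice_body "lissajous_polytope A" by (rule lattice_body_lissajous)
  let ?L = "lattice_points (lissajous_polytope A)"
  let ?S = "multi_indices (UNIV - {k}) K"
  let ?E = "{..<D} \<times> ?S"
  let ?\<Omega> = "lissajous_map A b"
  let ?\<phi> = "chart_monom z0 k"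
  define h where "h v = det (toric_jacobi A b v)" for v
  have finS: "finite ?S" and finE: "finite ?E"
    using card_multi_indices[of "UNIV - {k}" K] by auto
  from deg obtain U where \<delta>: "\<delta> > 0"
    and U: "openin (subtopology zariski (lissajous_disc A b)) U"
    and dense: "subtopology zariski (lissajous_disc A b) closure_of U = lissajous_disc A b"
    and fibre: "\<And>w. w \<in> U \<Longrightarrow> card {v. (v, w) \<in> ramification A b} = \<delta>"
    unfolding ramification_degree_def by blast
  have UV: "U \<subseteq> lissajous_disc A b"
    using openin_subset[OF U] by simp
  obtain T where T: "T \<subseteq> U" "finite T"
    and test: "\<forall>a. (\<forall>w\<in>T. (\<Sum>e\<in>?E. a e * ?\<phi> e w) = 0) \<longrightarrow> (\<forall>w\<in>U. (\<Sum>e\<in>?E. a e * ?\<phi> e w) = 0)"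
    using finite_vanishing_test[OF finE, of U ?\<phi>] by (elim exE conjE)
  have "finite {v. (v, w) \<in> ramification A b}" if "w \<in> T" for w
    using fibre[of w] T(1) that \<delta> by (intro card_ge_0_finite) auto
  then obtain x where x: "\<forall>w\<in>T. inj_on (linear_form x) {v. (v, w) \<in> ramification A b}"
    using separating_linear_form[OF T(2), of "\<lambda>w. {v. (v, w) \<in> ramification A b}"] by blast
  define \<theta> where "\<theta> = linear_form x"
  have indep: "a (i, e) = 0"
    if van: "\<And>v. v \<in> ctorus \<Longrightarrow> h v = 0 \<Longrightarrow> (\<Sum>(i, e)\<in>{..<\<delta>} \<times> ?E. a (i, e) * (\<theta> v ^ i * ?\<phi> e (?\<Omega> v))) = 0"
      and i: "i < \<delta>" and e: "e \<in> ?E" for a i e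
  proof -
    \<comment> \<open>The \<open>\<delta>\<close> distinct values of \<open>\<theta>\<close> on the
      fibre over \<open>w\<close> are roots of a polynomial of degree below \<open>\<delta>\<close>
      whose coefficients depend only on \<open>w\<close>.\<close>
    have "(\<Sum>e\<in>?E. a (i, e) * ?\<phi> e w) = 0" if w: "w \<in> T" for w
    proof (rule poly_many_roots_zero[of \<delta> "\<theta> ` {v. (v, w) \<in> ramification A b}" "\<lambda>i. \<Sum>e\<in>?E. a (i, e) * ?\<phi> e w", OF _ _ i])
      show "\<delta> \<le> card (\<theta> ` {v. (v, w) \<in> ramification A b})"
        using x w fibre[of w] T(1) unfolding \<theta>_def by (subst card_image) auto
      fix t assume "t \<in> \<theta> ` {v. (v, w) \<in> ramification A b}"
      then obtain v where v: "v \<in> ctorus" "?\<Omega> v = w" "h v = 0" "t = \<theta> v"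
        by (auto simp: ramification_eq h_def)
      have "(\<Sum>i<\<delta>. (\<Sum>e\<in>?E. a (i, e) * ?\<phi> e w) * t ^ i) =
          (\<Sum>(i, e)\<in>{..<\<delta>} \<times> ?E. a (i, e) * (\<theta> v ^ i * ?\<phi> e (?\<Omega> v)))"
        unfolding sum.cartesian_product[symmetric] sum_distrib_right v(2,4)
        by (intro sum.cong refl) (simp add: mult_ac)
      also have "\<dots> = 0" using van v by blast
      finally show "(\<Sum>i<\<delta>. (\<Sum>e\<in>?E. a (i, e) * ?\<phi> e w) * t ^ i) = 0" .
    qed
    then have "\<forall>w\<in>T. (\<Sum>e\<in>?E. a (i, e) * ?\<phi> e w) = 0" ..
    \<comment> \<open>Vanishing spreads from \<open>T\<close> to \<open>U\<close> by the choice of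
      \<open>T\<close>, and from there to the whole discriminant by density.\<close>
    then have onU: "\<forall>w\<in>U. (\<Sum>e\<in>?E. a (i, e) * ?\<phi> e w) = 0"
      using test[THEN spec, of "\<lambda>e. a (i, e)"] by (rule mp[rotated])
    have zero: "(\<Sum>e\<in>?E. a (i, e) * ?\<phi> e w) = 0" if "f w = 0" for w
    proof (rule polyfun_zero_on_closure[OF _ dense UV])
      show "(\<lambda>w. \<Sum>e\<in>?E. a (i, e) * ?\<phi> e w) \<in> polyfuns"
        by (intro polyfuns_sum polyfuns.mult polyfuns.const chart_monom_polyfun)
      show "w \<in> lissajous_disc A b" using that by (simp add: disc)
    qed (use onU in blast)
    obtain j \<mu> where e': "e = (j, \<mu>)" "j < D" "\<mu> \<in> ?S" using e by auto
    show ?thesis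
      unfolding e'(1)
      by (rule chart_monom_independent[OF f \<Delta> D k finS _ zero e'(2,3)]) (auto simp: multi_indices_def)
  qed
  define G where "G s = (case s of Inl m \<Rightarrow> (\<lambda>v. h v * tmonom m v)
    | Inr (i, e) \<Rightarrow> (\<lambda>v. \<theta> v ^ i * ?\<phi> e (?\<Omega> v)))" for s :: "int^'d + nat \<times> nat \<times> ('d \<Rightarrow> nat)"
  let ?I = "?L (n - CARD('d)) <+> {..<\<delta>} \<times> ?E"
  have h: "h \<in> Lk CARD('d)"
    unfolding h_def by (rule det_toric_jacobi_laurent)
  have \<Omega>: "(\<lambda>v. ?\<Omega> v $ i) \<in> Lk 1" for i
    by (rule lissajous_map_laurent)
  have \<theta>: "\<theta> \<in> Lk c"
    unfolding \<theta>_def linear_form_def by (intro Lk_sum Lk_scale coord)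
  have fst: "(\<lambda>v. chart_fst z0 k (?\<Omega> v)) \<in> Lk 1"
    unfolding chart_fst_def divide_inverse vector_minus_component
    using Lk_scale[OF Lk_diff[OF \<Omega> Lk_const]] by (simp add: mult.commute)
  have snd: "(\<lambda>v. chart_snd z0 k (?\<Omega> v) $ i) \<in> Lk 1" for i
  proof -
    have "(\<lambda>v. ?\<Omega> v $ i - line_point z0 $ i - line_dir z0 $ i * chart_fst z0 k (?\<Omega> v)) \<in> Lk 1"
      by (intro Lk_diff \<Omega> Lk_const Lk_scale fst)
    then show ?thesis
      by (simp add: chart_snd_def mult.commute)
  qed
  have "card ?I \<le> card (?L n)"
  proof (rule card_independent_laurent_le[of _ _ G])
    show "finite (?L n)" "finite ?I"
      using fin finE by auto
    fix s assume "s \<in> ?I"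
    then consider m where "s = Inl m" "m \<in> ?L (n - CARD('d))"
      | i j \<mu> where "s = Inr (i, j, \<mu>)" "i < \<delta>" "j < D" "\<mu> \<in> ?S"
      by auto
    then show "G s \<in> Lk n"
    proof cases
      case 1
      have "(\<lambda>v. h v * (1 * tmonom m v)) \<in> Lk (CARD('d) + (n - CARD('d)))"
        by (intro Lk_mult h Lk_monom 1)
      then show ?thesis
        using n(2) by (simp add: G_def 1)
    next
      case 2
      have "(\<lambda>v. \<theta> v ^ i * (chart_fst z0 k (?\<Omega> v) ^ j * (\<Prod>l\<in>UNIV. chart_snd z0 k (?\<Omega> v) $ l ^ \<mu> l)))
          \<in> Lk (i * c + (j * 1 + (\<Sum>l\<in>UNIV. \<mu> l * 1)))"
        by (intro Lk_mult Lk_power Lk_prod \<theta> fst snd finite_class.finite_UNIV)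
      \<comment> \<open>The three kinds of factors contribute at most \<open>\<delta> * c\<close>,
        \<open>D\<close> and \<open>K\<close>, whence the value of \<open>n\<close>.\<close>
      moreover have "i * c + (j * 1 + (\<Sum>l\<in>UNIV. \<mu> l * 1)) \<le> n"
      proof -
        have "i * c \<le> \<delta> * c" using 2 by simp
        moreover have "(\<Sum>l\<in>UNIV. \<mu> l) = \<mu> k + (\<Sum>l\<in>UNIV - {k}. \<mu> l)"
          by (rule sum.remove) simp_all
        moreover have "\<mu> k = 0" "(\<Sum>l\<in>UNIV - {k}. \<mu> l) \<le> K"
          using 2(4) by (simp_all add: multi_indices_def)
        ultimately show ?thesis
          using 2(3) n(1) unfolding mult_1_right by linarith
      qed
      ultimately show ?thesis
        unfolding 2(1) G_def by (auto simp: chart_monom_def intro: Lk_mono)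
    qed
  next
    fix a assume "\<And>v. v \<in> ctorus \<Longrightarrow> (\<Sum>s\<in>?I. a s * G s v) = 0"
    then have sum: "(\<Sum>m\<in>?L (n - CARD('d)). a (Inl m) * (h v * tmonom m v)) +
        (\<Sum>(i, e)\<in>{..<\<delta>} \<times> ?E. a (Inr (i, e)) * (\<theta> v ^ i * ?\<phi> e (?\<Omega> v))) = 0" if "v \<in> ctorus" for v
      using that fin finE by (simp add: sum.Plus G_def case_prod_unfold)
    have Inr: "a (Inr (i, e)) = 0" if "i < \<delta>" "e \<in> ?E" for i e
    proof (rule indep[of "\<lambda>p. a (Inr p)", OF _ that])
      fix v assume "v \<in> ctorus" "h v = 0"
      then show "(\<Sum>(i, e)\<in>{..<\<delta>} \<times> ?E. a (Inr (i, e)) * (\<theta> v ^ i * ?\<phi> e (?\<Omega> v))) = 0"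
        using sum[of v] by simp
    qed
    define g where "g v = (\<Sum>m\<in>?L (n - CARD('d)). a (Inl m) * tmonom m v)" for v
    \<comment> \<open>What remains of the relation is \<open>h\<close> times \<open>g\<close>. Since
      the torus is irreducible and \<open>h\<close> is not identically zero on it, \<open>g\<close>
      vanishes there.\<close>
    have hg: "h v * g v = 0" if "v \<in> ctorus" for v
    proof -
      have "(\<Sum>(i, e)\<in>{..<\<delta>} \<times> ?E. a (Inr (i, e)) * (\<theta> v ^ i * ?\<phi> e (?\<Omega> v))) = 0"
        by (rule sum.neutral) (use Inr in \<open>simp add: case_prod_unfold\<close>)
      then show ?thesis
        using sum[OF that] by (simp add: g_def sum_distrib_left mult_ac)
    qed
    have gL: "g \<in> Lk (n - CARD('d))"
      by (rule laurentI) (rule g_def)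
    obtain v0 where v0: "v0 \<in> ctorus" "h v0 \<noteq> 0"
      using det_toric_jacobi_nonzero[OF deg] unfolding h_def by blast
    have g0: "g v = 0" if v: "v \<in> ctorus" for v
    proof (rule ccontr)
      assume "g v \<noteq> 0"
      from laurent_mult_nonzero[OF fin fin h gL v0 v this] hg show False by auto
    qed
    have Inl: "a (Inl m) = 0" if "m \<in> ?L (n - CARD('d))" for m
      by (rule tmonom_independent[OF fin _ that]) (use g0 in \<open>simp add: g_def\<close>)
    show "\<forall>s\<in>?I. a s = 0"
      using Inl Inr by auto
  qed
  moreover have "card ?I = card (?L (n - CARD('d))) + \<delta> * (D * card ?S)"
    using fin finE by (simp add: card_Plus card_cartesian_product)
  ultimately show ?thesis by simp
qed

theorem theorem6p8:
  fixes A :: "int^'n^'d" and b :: "complex^'n" and \<delta> :: nat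
  assumes "rank (map_matrix real_of_int A) = CARD('d)"
    and "hypersurface (lissajous_disc A b)"
    and "ramification_degree A b \<delta>"
  shows "\<exists>D. has_degree (lissajous_disc A b) D \<and>
    real D \<le> inverse (real \<delta>) * (real CARD('d) * fact CARD('d) * measure lborel (lissajous_polytope A))"
proof -
  let ?P = "lissajous_polytope A" and ?V = "measure lborel (lissajous_polytope A)"
  interpret lattice_body ?P by (rule lattice_body_lissajous)
  obtain f where f: "f \<in> polyfuns" "\<nexists>c. f = (\<lambda>_. c)" and disc: "lissajous_disc A b = {w. f w = 0}"
    using assms(2) unfolding hypersurface_def by blast
  have nz: "f \<noteq> (\<lambda>_. 0)" using f(2) by blast
  obtain D z0 \<Delta> where \<Delta>: "\<Delta> \<in> polyfuns" "\<Delta> z0 \<noteq> 0" and dir: "D > 0 \<Longrightarrow> line_dir z0 \<noteq> 0"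
    and D: "\<And>z. \<Delta> z \<noteq> 0 \<Longrightarrow> line_restrict f z \<noteq> 0 \<and> card {t. poly (line_restrict f z) t = 0} = D"
    by (rule generic_line[OF f(1) nz]) (rule that)
  have "has_degree (lissajous_disc A b) D"
    unfolding disc by (rule has_degree_generic_line[OF f(1) \<Delta> D])
  moreover have "real D \<le> inverse (real \<delta>) * (real CARD('d) * fact CARD('d) * ?V)"
  \<comment> \<open>For \<open>D = 0\<close> the right-hand side only has to be nonnegative.
    Otherwise the direction of the generic line has a nonzero component that normalizes the
    chart.\<close>
  proof (cases "D = 0")
    case False
    then obtain k where k: "line_dir z0 $ k \<noteq> 0"
      using dir by (auto simp: vec_eq_iff)
    obtain c where c: "\<And>i. (\<lambda>v. v $ i) \<in> Lk c"
      using coordinate_laurent[OF assms(1)] by blast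
    obtain C where C: "C \<ge> 0" "box 0 1 \<subseteq> (*\<^sub>R) C ` ?P"
      using unit_cube_absorbed[OF assms(1)] by metis
    \<comment> \<open>The growth factor is \<open>\<delta> * D\<close>, and the fixed shift
      \<open>\<delta> * c + D\<close> disappears in the limit.\<close>
    have "real (\<delta> * D) \<le> real CARD('d) * fact CARD('d) * ?V"
    proof (rule asymptotic_count)
      fix K
      show "CARD('d) \<le> \<delta> * c + D + K \<Longrightarrow> card (lattice_points ?P (\<delta> * c + D + K - CARD('d))) +
          \<delta> * D * card (multi_indices (UNIV - {k}) K) \<le> card (lattice_points ?P (\<delta> * c + D + K))"
        using counting_inequality[OF disc f(1) assms(3) \<Delta> _ k c refl] D by (simp add: mult.assoc)
      show "real K ^ (CARD('d) - 1) / fact (CARD('d) - 1) \<le> real (card (multi_indices (UNIV - {k}) K))"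
        using card_multi_indices[of "UNIV - {k}" K] by (simp add: card_Diff_singleton)
      show "real (card (lattice_points ?P K)) \<le> (real K + C) ^ CARD('d) * ?V"
        by (rule card_lattice_points_le[OF convex compact C])
    qed simp
    moreover have "\<delta> > 0"
      using assms(3) by (simp add: ramification_degree_def)
    ultimately show ?thesis
      by (simp add: field_simps)
  qed simp
  ultimately show ?thesis by blast
qed

end
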